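(* Let $n\ge m\ge2$, and let $H\le F_m$ be a maximal subgroup of $F_m$ isomorphic to $F_n$. Then the action of $H$ on $(0,1)$ is minimal.
   Context: $F_n$ is the group of increasing piecewise-linear homeomorphisms of $[0,1]$ with finitely many breakpoints, all in $\mathbb Z[1/n]$, and slopes integer powers of $n$; it acts on $(0,1)$. An action of a group of homeomorphisms on $(0,1)$ is minimal if every orbit is dense in $(0,1)$; equivalently, there is no nonempty proper closed (in $(0,1)$) invariant subset. *)

theory Defs
  imports "HOL-Analysis.Analysis" "HOL-Algebra.Group_Action"
begin

definition Z_inverse :: "nat \<Rightarrow> real set" where
  "Z_inverse n = {of_int a / of_nat n ^ k | (a::int) (k::nat). True}"

text \<open>
  Below, \<open>B\<close> is a finite set containing all breakpoints of \<open>f\<close>; it may contain further points.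
\<close>

definition PL_adic :: "nat \<Rightarrow> (real \<Rightarrow> real) \<Rightarrow> bool" where
  "PL_adic n f \<longleftrightarrow>
     (\<exists>B. finite B \<and> B \<subseteq> Z_inverse n \<and>
       (\<forall>a b. 0 \<le> a \<and> a < b \<and> b \<le> 1 \<and> {a<..<b} \<inter> B = {} \<longrightarrow>
         (\<exists>(k::int) c. \<forall>x\<in>{a..b}. f x = of_nat n powi k * x + c)))"

text \<open>
  The group of homeomorphisms is realised inside the library's group \<open>BijGroup {0..1}\<close> of
  permutations of the interval, whose elements take the value \<open>undefined\<close> outside it and whose
  multiplication is composition.
\<close>

definition thompson_F :: "nat \<Rightarrow> (real \<Rightarrow> real) monoid" where
  "thompson_F n = (BijGroup {0..1})
     \<lparr>carrier := {f \<in> extensional {0..1}.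
        (\<exists>g. homeomorphism {0..1} {0..1} f g) \<and> strict_mono_on {0..1} f \<and> PL_adic n f}\<rparr>"

definition maximal_subgroup :: "'a set \<Rightarrow> ('a, 'b) monoid_scheme \<Rightarrow> bool" where
  "maximal_subgroup H G \<longleftrightarrow> subgroup H G \<and> H \<noteq> carrier G \<and>
     (\<forall>K. subgroup K G \<and> H \<subseteq> K \<longrightarrow> K = H \<or> K = carrier G)"

locale minimal_action = group_action G E \<phi>
  for G (structure) and E :: "'a::topological_space set" and \<phi> +
  assumes dense_orbits: "x \<in> E \<Longrightarrow> E \<subseteq> closure (orbit G \<phi> x)"


subsection \<open>\<open>thompson_F n\<close> is a group acting on the open interval\<close>

lemma Z_inverse_0: "0 \<in> Z_inverse n"
  unfolding Z_inverse_def by (auto intro!: exI[of _ 0])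

lemma Z_inverse_add:
  assumes n: "n \<ge> 2" and "x \<in> Z_inverse n" "y \<in> Z_inverse n"
  shows "x + y \<in> Z_inverse n"
proof -
  obtain a k where x: "x = of_int a / of_nat n ^ k"
    using assms unfolding Z_inverse_def by blast
  obtain b l where y: "y = of_int b / of_nat n ^ l"
    using assms unfolding Z_inverse_def by blast
  have "x + y = of_int (a * int n ^ l + b * int n ^ k) / of_nat n ^ (k + l)"
    using n by (simp add: x y field_simps power_add)
  then show ?thesis unfolding Z_inverse_def by blast
qed

lemma Z_inverse_uminus: "x \<in> Z_inverse n \<Longrightarrow> - x \<in> Z_inverse n"
  unfolding Z_inverse_def
proof safe
  fix a :: int and k :: nat
  show "\<exists>b l. - (of_int a / real n ^ k) = of_int b / real n ^ l \<and> True"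
    by (rule exI[of _ "- a"], rule exI[of _ k]) simp
qed

lemma Z_inverse_add_iff:
  assumes n: "n \<ge> 2" and x: "x \<in> Z_inverse n"
  shows "y + x \<in> Z_inverse n \<longleftrightarrow> y \<in> Z_inverse n"
  using Z_inverse_add[OF n _ Z_inverse_uminus[OF x], of "y + x"] Z_inverse_add[OF n _ x, of y]
  by auto

lemma Z_inverse_powi:
  assumes n: "n \<ge> 2" and "x \<in> Z_inverse n"
  shows "of_nat n powi k * x \<in> Z_inverse n"
proof -
  obtain a l where x: "x = of_int a / of_nat n ^ l"
    using assms unfolding Z_inverse_def by blast
  show ?thesis
  proof (cases "k \<ge> 0")
    case True
    have "of_nat n powi k * x = of_int (a * int n ^ nat k) / of_nat n ^ l"
      using True by (simp add: x power_int_def)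
    then show ?thesis unfolding Z_inverse_def by blast
  next
    case False
    have "of_nat n powi k * x = of_int a / of_nat n ^ (l + nat (- k))"
      using False by (simp add: x power_int_def power_add field_simps)
    then show ?thesis unfolding Z_inverse_def by blast
  qed
qed

lemma Z_inverse_powi_iff:
  assumes n: "n \<ge> 2"
  shows "of_nat n powi k * x \<in> Z_inverse n \<longleftrightarrow> x \<in> Z_inverse n"
proof
  assume "of_nat n powi k * x \<in> Z_inverse n"
  from Z_inverse_powi[OF n this, of "- k"] show "x \<in> Z_inverse n"
    using n by (simp add: power_int_minus field_simps)
qed (rule Z_inverse_powi[OF n])

lemma PL_adicI:
  assumes "finite B" "B \<subseteq> Z_inverse n"
    and "\<And>a b. \<lbrakk>0 \<le> a; a < b; b \<le> 1; {a<..<b} \<inter> B = {}\<rbrakk>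
       \<Longrightarrow> \<exists>(k::int) c. \<forall>x\<in>{a..b}. f x = of_nat n powi k * x + c"
  shows "PL_adic n f"
  unfolding PL_adic_def using assms by (intro exI[of _ B]) simp

lemma PL_adicE:
  assumes "PL_adic n f"
  obtains B where "finite B" "B \<subseteq> Z_inverse n"
    "\<And>a b. \<lbrakk>0 \<le> a; a < b; b \<le> 1; {a<..<b} \<inter> B = {}\<rbrakk>
       \<Longrightarrow> \<exists>(k::int) c. \<forall>x\<in>{a..b}. f x = of_nat n powi k * x + c"
proof -
  from assms obtain B where B: "finite B \<and> B \<subseteq> Z_inverse n \<and>
       (\<forall>a b. 0 \<le> a \<and> a < b \<and> b \<le> 1 \<and> {a<..<b} \<inter> B = {} \<longrightarrow>
         (\<exists>(k::int) c. \<forall>x\<in>{a..b}. f x = of_nat n powi k * x + c))"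
    unfolding PL_adic_def by (rule exE)
  show thesis
    using B[THEN conjunct2, THEN conjunct2, rule_format] B by (intro that[of B]) simp_all
qed

lemma PL_adic_Z_inverse_iff:
  assumes n: "n \<ge> 2" and pl: "PL_adic n f" and f0: "f 0 = 0" and x: "x \<in> {0..1}"
  shows "f x \<in> Z_inverse n \<longleftrightarrow> x \<in> Z_inverse n"
proof -
  obtain B where B: "finite B" "B \<subseteq> Z_inverse n"
    and aff: "\<And>a b. \<lbrakk>0 \<le> a; a < b; b \<le> 1; {a<..<b} \<inter> B = {}\<rbrakk>
               \<Longrightarrow> \<exists>k c. \<forall>x\<in>{a..b}. f x = of_nat n powi k * x + c"
    by (rule PL_adicE[OF pl], rule that)
  have step: "f b \<in> Z_inverse n \<longleftrightarrow> b \<in> Z_inverse n"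
    if ab: "0 \<le> a" "a < b" "b \<le> 1" "{a<..<b} \<inter> B = {}"
      and Z: "a \<in> Z_inverse n" "f a \<in> Z_inverse n" for a b
  proof -
    obtain k c where k: "\<forall>x\<in>{a..b}. f x = of_nat n powi k * x + c"
      using aff[OF ab] by (elim exE)
    have "f b = of_nat n powi k * (b + - a) + f a"
      using ab k by (simp add: algebra_simps)
    then have "f b \<in> Z_inverse n \<longleftrightarrow> of_nat n powi k * (b + - a) \<in> Z_inverse n"
      using Z_inverse_add_iff[OF n Z(2)] by simp
    also have "\<dots> \<longleftrightarrow> b + - a \<in> Z_inverse n"
      by (rule Z_inverse_powi_iff[OF n])
    also have "\<dots> \<longleftrightarrow> b \<in> Z_inverse n"
      using Z_inverse_add_iff[OF n Z_inverse_uminus[OF Z(1)]] by simp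
    finally show ?thesis .
  qed
  show ?thesis
    using x
  proof (induction "card (B \<inter> {0<..<x})" arbitrary: x rule: less_induct)
    case less
    consider "x = 0" | "x > 0" "B \<inter> {0<..<x} = {}" | "B \<inter> {0<..<x} \<noteq> {}"
      using less.prems by fastforce
    then show ?case
    proof cases
      case 1
      then show ?thesis by (simp add: f0)
    next
      case 2
      then show ?thesis
        using step[of 0 x] less.prems by (auto simp: f0 Z_inverse_0)
    next
      case 3
      define p where "p = Max (B \<inter> {0<..<x})"
      have fin: "finite (B \<inter> {0<..<x})" using B by blast
      have p: "p \<in> B \<inter> {0<..<x}"
        unfolding p_def using 3 fin by (rule Max_in[rotated])
      have gap: "{p<..<x} \<inter> B = {}"
        using p Max_ge[OF fin] unfolding p_def[symmetric] by force
      have "B \<inter> {0<..<p} \<subset> B \<inter> {0<..<x}"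
        using p by auto
      then have "card (B \<inter> {0<..<p}) < card (B \<inter> {0<..<x})"
        using fin psubset_card_mono by blast
      then have "f p \<in> Z_inverse n"
        using less.hyps[of p] p B less.prems by auto
      then show ?thesis
        using step[of p x] p gap B less.prems by auto
    qed
  qed
qed

lemma strict_mono_on_homeo_endpoint:
  fixes f :: "real \<Rightarrow> real"
  assumes "strict_mono_on {0..1} f" "f ` {0..1} = {0..1}"
  shows "f 0 = 0"
proof -
  obtain z where z: "z \<in> {0..1}" "f z = 0"
    using assms(2) by (metis atLeastAtMost_iff image_iff order_refl zero_le_one)
  have "f 0 \<ge> 0" using assms(2) by fastforce
  moreover have "f 0 \<le> f z"
    using assms(1) z by (meson atLeastAtMost_iff order_refl strict_mono_on_leD zero_le_one)
  ultimately show ?thesis using z by simp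
qed

lemma carrier_thompson_F:
  "f \<in> carrier (thompson_F n) \<longleftrightarrow> f \<in> extensional {0..1} \<and>
     (\<exists>g. homeomorphism {0..1} {0..1} f g) \<and> strict_mono_on {0..1} f \<and> PL_adic n f"
  by (simp add: thompson_F_def)

lemma carrier_thompson_F_facts:
  assumes "f \<in> carrier (thompson_F n)"
  shows "f \<in> Bij {0..1}" "bij_betw f {0..1} {0..1}" "f 0 = 0"
    "strict_mono_on {0..1} f" "PL_adic n f"
proof -
  obtain g where g: "homeomorphism {0..1} {0..1} f g"
    using assms by (auto simp: carrier_thompson_F)
  have im: "f ` {0..1} = {0..1}" using g by (simp add: homeomorphism_def)
  moreover have "inj_on f {0..1}" using g unfolding homeomorphism_def by (metis inj_on_inverseI)
  ultimately show bij: "bij_betw f {0..1} {0..1}" by (simp add: bij_betw_def)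
  then show "f \<in> Bij {0..1}" using assms by (simp add: Bij_def carrier_thompson_F)
  show "f 0 = 0"
    using strict_mono_on_homeo_endpoint im assms by (simp add: carrier_thompson_F)
  show "strict_mono_on {0..1} f" "PL_adic n f"
    using assms by (simp_all add: carrier_thompson_F)
qed

lemma PL_adic_compose:
  assumes n: "n \<ge> 2" and f: "f \<in> carrier (thompson_F n)" and g: "g \<in> carrier (thompson_F n)"
  shows "PL_adic n (compose {0..1} f g)"
proof -
  note fb = carrier_thompson_F_facts[OF f] and gb = carrier_thompson_F_facts[OF g]
  obtain A where A: "finite A" "A \<subseteq> Z_inverse n"
    and affA: "\<And>a b. \<lbrakk>0 \<le> a; a < b; b \<le> 1; {a<..<b} \<inter> A = {}\<rbrakk>
               \<Longrightarrow> \<exists>k c. \<forall>x\<in>{a..b}. f x = of_nat n powi k * x + c"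
    by (rule PL_adicE[OF fb(5)], rule that)
  obtain B where B: "finite B" "B \<subseteq> Z_inverse n"
    and affB: "\<And>a b. \<lbrakk>0 \<le> a; a < b; b \<le> 1; {a<..<b} \<inter> B = {}\<rbrakk>
               \<Longrightarrow> \<exists>k c. \<forall>x\<in>{a..b}. g x = of_nat n powi k * x + c"
    by (rule PL_adicE[OF gb(5)], rule that)
  have mono: "g x < g y" if "x \<in> {0..1}" "y \<in> {0..1}" "x < y" for x y
    using strict_mono_onD[OF gb(4)] that by blast
  have rng: "g x \<in> {0..1}" if "x \<in> {0..1}" for x
    using gb(2) that by (meson bij_betwE)
  define C where "C = B \<union> {x \<in> {0..1}. g x \<in> A}"
  have "finite {x \<in> {0..1}. g x \<in> A}"
    using finite_vimage_IntI[OF A(1), of g "{0..1}"] gb(2)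
    by (simp add: bij_betw_def vimage_def Int_def conj_commute)
  then have C: "finite C" using B by (simp add: C_def)
  have CZ: "C \<subseteq> Z_inverse n"
    using A B PL_adic_Z_inverse_iff[OF n gb(5) gb(3)] unfolding C_def by blast
  have "\<exists>k c. \<forall>x\<in>{a..b}. compose {0..1} f g x = of_nat n powi k * x + c"
    if ab: "0 \<le> a" "a < b" "b \<le> 1" "{a<..<b} \<inter> C = {}" for a b
  proof -
    obtain k c where k: "\<forall>x\<in>{a..b}. g x = of_nat n powi k * x + c"
      using affB[OF ab(1-3)] ab(4) unfolding C_def by (metis Int_Un_distrib Un_empty)
    have "{g a<..<g b} \<inter> A = {}"
    proof (rule ccontr)
      assume "{g a<..<g b} \<inter> A \<noteq> {}"
      then obtain y where y: "g a < y" "y < g b" "y \<in> A" by auto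
      have "y \<in> {0..1}" using y rng[of a] rng[of b] ab by auto
      then obtain x where x: "x \<in> {0..1}" "g x = y"
        using gb(2) by (metis bij_betw_def imageE)
      have "a < x" using mono[of x a] y x ab by (cases "x = a") (auto simp: not_less)
      moreover have "x < b" using mono[of b x] y x ab by (cases "x = b") (auto simp: not_less)
      ultimately show False using ab(4) x y by (auto simp: C_def)
    qed
    then obtain l d where l: "\<forall>x\<in>{g a..g b}. f x = of_nat n powi l * x + d"
      using affA[of "g a" "g b"] rng[of a] rng[of b] mono[of a b] ab by auto
    have "compose {0..1} f g x = of_nat n powi (l + k) * x + (of_nat n powi l * c + d)"
      if x: "x \<in> {a..b}" for x
    proof -
      have "g x \<in> {g a..g b}"
        using mono[of a x] mono[of x b] x ab by (cases "x = a"; cases "x = b") auto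
      then have "f (g x) = of_nat n powi l * g x + d" using l by blast
      then show ?thesis
        using x ab k n by (simp add: compose_def power_int_add algebra_simps)
    qed
    then show ?thesis by blast
  qed
  then show ?thesis by (rule PL_adicI[OF C CZ])
qed

lemma PL_adic_inverse:
  assumes n: "n \<ge> 2" and f: "f \<in> carrier (thompson_F n)"
  shows "PL_adic n (restrict (inv_into {0..1} f) {0..1})" (is "PL_adic n ?h")
proof -
  note fb = carrier_thompson_F_facts[OF f]
  obtain B where B: "finite B" "B \<subseteq> Z_inverse n"
    and aff: "\<And>a b. \<lbrakk>0 \<le> a; a < b; b \<le> 1; {a<..<b} \<inter> B = {}\<rbrakk>
               \<Longrightarrow> \<exists>k c. \<forall>x\<in>{a..b}. f x = of_nat n powi k * x + c"
    by (rule PL_adicE[OF fb(5)], rule that)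
  have sm: "strict_mono_on {0..1} f"
    using f by (simp add: carrier_thompson_F)
  have h: "?h y \<in> {0..1}" "f (?h y) = y" if "y \<in> {0..1}" for y
    using that fb(2) by (auto simp: bij_betw_def f_inv_into_f intro: inv_into_into)
      (metis atLeastAtMost_iff inv_into_into)+
  have less: "?h y < ?h z" if "y \<in> {0..1}" "z \<in> {0..1}" "y < z" for y z
    using h[OF that(1)] h[OF that(2)] that(3) sm strict_mono_on_less by metis
  define C where "C = f ` (B \<inter> {0..1})"
  have C: "finite C" using B by (simp add: C_def)
  have CZ: "C \<subseteq> Z_inverse n"
    using B PL_adic_Z_inverse_iff[OF n fb(5) fb(3)] unfolding C_def by blast
  have "\<exists>k c. \<forall>x\<in>{a..b}. ?h x = of_nat n powi k * x + c"
    if ab: "0 \<le> a" "a < b" "b \<le> 1" "{a<..<b} \<inter> C = {}" for a b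
  proof -
    have abI: "a \<in> {0..1}" "b \<in> {0..1}" using ab by auto
    have "{?h a<..<?h b} \<inter> B = {}"
    proof (rule ccontr)
      assume "{?h a<..<?h b} \<inter> B \<noteq> {}"
      then obtain x where x: "?h a < x" "x < ?h b" "x \<in> B" by (auto simp del: restrict_apply)
      have xI: "x \<in> {0..1}"
        using x h(1)[OF abI(1)] h(1)[OF abI(2)] by (auto simp del: restrict_apply)
      have "a < f x" "f x < b"
        using strict_mono_onD[OF sm h(1)[OF abI(1)] xI x(1)]
          strict_mono_onD[OF sm xI h(1)[OF abI(2)] x(2)] h(2) abI by metis+
      then show False using ab(4) x(3) xI by (auto simp: C_def)
    qed
    then obtain k c where k: "\<forall>x\<in>{?h a..?h b}. f x = of_nat n powi k * x + c"
      using aff[of "?h a" "?h b"] h(1)[OF abI(1)] h(1)[OF abI(2)] less[OF abI ab(2)]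
      unfolding atLeastAtMost_iff by metis
    have "?h y = of_nat n powi (- k) * y + (- (of_nat n powi (- k) * c))" if y: "y \<in> {a..b}" for y
    proof -
      have yI: "y \<in> {0..1}" using y ab by auto
      have "?h y \<in> {?h a..?h b}"
        using less[OF abI(1) yI] less[OF yI abI(2)] y
        by (cases "y = a"; cases "y = b") (auto simp del: restrict_apply)
      then have "y = of_nat n powi k * ?h y + c" using k h(2)[OF yI] by metis
      then have "of_nat n powi (- k) * (y - c) = of_nat n powi (- k) * (of_nat n powi k * ?h y)"
        by simp
      also have "\<dots> = ?h y" using n by (simp add: power_int_minus)
      finally show ?thesis by (simp only: right_diff_distrib)
    qed
    then show ?thesis by blast
  qed
  then show ?thesis by (rule PL_adicI[OF C CZ])
qed

lemma subgroup_thompson_F: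
  assumes n: "n \<ge> 2"
  shows "subgroup (carrier (thompson_F n)) (BijGroup {0..1})"
proof (rule group.subgroupI[OF group_BijGroup])
  show "carrier (thompson_F n) \<subseteq> carrier (BijGroup {0..1})"
    using carrier_thompson_F_facts(1) by (auto simp: BijGroup_def)
  have "homeomorphism {0..1} {0..1} (\<lambda>x\<in>{0..1}. x) (\<lambda>x::real. x)"
    by (rule homeomorphism_cong[OF homeomorphism_ident]) auto
  moreover have "PL_adic n (\<lambda>x\<in>{0..1}. x)"
    unfolding PL_adic_def by (intro exI[of _ "{}"]) (auto intro!: exI[of _ 0])
  ultimately have "(\<lambda>x\<in>{0..1}. x) \<in> carrier (thompson_F n)"
    by (auto simp: carrier_thompson_F strict_mono_on_def)
  then show "carrier (thompson_F n) \<noteq> {}" by blast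
next
  fix f assume f: "f \<in> carrier (thompson_F n)"
  let ?h = "restrict (inv_into {0..1} f) {0..1}"
  note fb = carrier_thompson_F_facts[OF f]
  obtain g where g: "homeomorphism {0..1} {0..1} f g"
    using f by (auto simp: carrier_thompson_F)
  have gh: "g y = ?h y" if "y \<in> {0..1}" for y
  proof -
    have "g y \<in> {0..1}" "f (g y) = y"
      using g that unfolding homeomorphism_def by blast+
    then have "inv_into {0..1} f y = g y"
      using inv_into_f_f[of f "{0..1}" "g y"] fb(2) by (simp add: bij_betw_def)
    then show ?thesis using that by simp
  qed
  have "homeomorphism {0..1} {0..1} g f" using g by (rule homeomorphism_symD)
  then have hom: "homeomorphism {0..1} {0..1} ?h f"
    by (rule homeomorphism_cong) (simp_all add: gh)
  have "strict_mono_on {0..1} ?h"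
  proof (rule strict_mono_onI)
    fix y z :: real assume yz: "y \<in> {0..1}" "z \<in> {0..1}" "y < z"
    have "?h y \<in> {0..1}" "f (?h y) = y" "?h z \<in> {0..1}" "f (?h z) = z"
      using hom yz unfolding homeomorphism_def by blast+
    then show "?h y < ?h z"
      using f yz(3) strict_mono_on_less[of "{0..1}" f] unfolding carrier_thompson_F by metis
  qed
  then have "?h \<in> carrier (thompson_F n)"
    using hom PL_adic_inverse[OF n f] unfolding carrier_thompson_F by blast
  then show "inv\<^bsub>BijGroup {0..1}\<^esub> f \<in> carrier (thompson_F n)"
    by (simp add: inv_BijGroup fb(1))
next
  fix f g assume fg: "f \<in> carrier (thompson_F n)" "g \<in> carrier (thompson_F n)"
  note fb = carrier_thompson_F_facts[OF fg(1)] and gb = carrier_thompson_F_facts[OF fg(2)]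
  obtain f' g' where "homeomorphism {0..1} {0..1} f f'" "homeomorphism {0..1} {0..1} g g'"
    using fg by (auto simp: carrier_thompson_F)
  then have "homeomorphism {0..1} {0..1} (f \<circ> g) (g' \<circ> f')"
    using homeomorphism_compose by blast
  then have "homeomorphism {0..1} {0..1} (compose {0..1} f g) (g' \<circ> f')"
    by (rule homeomorphism_cong) (auto simp: compose_def)
  moreover have "strict_mono_on {0..1} (compose {0..1} f g)"
    using fg bij_betwE[OF gb(2)] unfolding carrier_thompson_F strict_mono_on_def compose_def
    by auto
  ultimately have "compose {0..1} f g \<in> carrier (thompson_F n)"
    using PL_adic_compose[OF n fg] by (auto simp: carrier_thompson_F)
  then show "f \<otimes>\<^bsub>BijGroup {0..1}\<^esub> g \<in> carrier (thompson_F n)"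
    using fb gb by (simp add: BijGroup_def)
qed

lemma group_thompson_F:
  assumes "n \<ge> 2"
  shows "group (thompson_F n)"
proof -
  have "thompson_F n = (BijGroup {0..1})\<lparr>carrier := carrier (thompson_F n)\<rparr>"
    by (simp add: thompson_F_def)
  then show ?thesis
    using subgroup.subgroup_is_group[OF subgroup_thompson_F[OF assms] group_BijGroup] by simp
qed

lemma group_action_thompson_F:
  assumes n: "n \<ge> 2" and H: "subgroup H (thompson_F n)"
  shows "group_action ((thompson_F n)\<lparr>carrier := H\<rparr>) {0<..<1} (\<lambda>h. restrict h {0<..<1})"
proof -
  have bij: "bij_betw f {0<..<1} {0<..<1}" if f: "f \<in> carrier (thompson_F n)" for f
  proof -
    note fb = carrier_thompson_F_facts[OF f]
    have sm: "strict_mono_on {0..1} f" using f by (simp add: carrier_thompson_F)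
    obtain z where z: "z \<in> {0..1}" "f z = 1"
      using fb(2) by (metis atLeastAtMost_iff bij_betw_def image_iff order_refl zero_le_one)
    have "f 1 \<le> 1" using bij_betwE[OF fb(2)] by auto
    moreover have "f z \<le> f 1"
      using sm z by (meson atLeastAtMost_iff order_refl strict_mono_on_leD zero_le_one)
    ultimately have f1: "f 1 = 1" using z by simp
    have "bij_betw f ({0..1} - {0, 1}) ({0..1} - {0, 1})"
      using bij_betw_DiffI[OF fb(2), of "{0, 1}" "{0, 1}"] fb(3) f1 by (simp add: bij_betw_def)
    moreover have "{0..1} - {0, 1} = {0<..<1::real}" by auto
    ultimately show ?thesis by simp
  qed
  have sub: "H \<subseteq> carrier (thompson_F n)" using H by (rule subgroup.subset)
  have grp: "group ((thompson_F n)\<lparr>carrier := H\<rparr>)"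
    using subgroup.subgroup_is_group[OF H group_thompson_F[OF n]] .
  have "(\<lambda>h. restrict h {0<..<1})
      \<in> hom ((thompson_F n)\<lparr>carrier := H\<rparr>) (BijGroup {0<..<1})"
  proof (rule homI)
    fix f assume "f \<in> carrier ((thompson_F n)\<lparr>carrier := H\<rparr>)"
    then show "restrict f {0<..<1} \<in> carrier (BijGroup {0<..<1})"
      using bij[of f] sub by (auto simp: BijGroup_def Bij_def)
  next
    fix f g
    assume "f \<in> carrier ((thompson_F n)\<lparr>carrier := H\<rparr>)" "g \<in> carrier ((thompson_F n)\<lparr>carrier := H\<rparr>)"
    then have fg: "f \<in> carrier (thompson_F n)" "g \<in> carrier (thompson_F n)"
      using sub by auto
    have rB: "restrict f {0<..<1} \<in> Bij {0<..<1}" "restrict g {0<..<1} \<in> Bij {0<..<1}"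
      using bij[OF fg(1)] bij[OF fg(2)] by (auto simp: Bij_def)
    have "restrict (compose {0..1} f g) {0<..<1}
        = compose {0<..<1} (restrict f {0<..<1}) (restrict g {0<..<1})"
      using bij_betwE[OF bij[OF fg(2)]] by (auto simp: compose_def restrict_def fun_eq_iff)
    then show "restrict (f \<otimes>\<^bsub>(thompson_F n)\<lparr>carrier := H\<rparr>\<^esub> g) {0<..<1}
        = restrict f {0<..<1} \<otimes>\<^bsub>BijGroup {0<..<1}\<^esub> restrict g {0<..<1}"
      using rB carrier_thompson_F_facts(1)[OF fg(1)] carrier_thompson_F_facts(1)[OF fg(2)]
      by (simp add: thompson_F_def BijGroup_def)
  qed
  then show ?thesis
    unfolding group_action_def group_hom_def group_hom_axioms_def
    using grp group_BijGroup by blast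
qed

end

theory Submission
  imports Defs
begin

text \<open>
  In \<open>F\<^sub>n\<close>, for any nontrivial \<open>a\<close> and \<open>b\<close> some conjugate of \<open>a\<close> commutes with neither \<open>a\<close> nor
  \<open>b\<close>: one can conjugate \<open>a\<close> so that its support meets both supports, and then small bumps destroy
  the remaining commutations. If an orbit of \<open>H\<close> is not dense, the complement \<open>V\<close> of its closure is
  open and \<open>H\<close>-invariant, so by maximality \<open>H\<close> is the full stabiliser of \<open>V\<close> in \<open>F\<^sub>m\<close> (if
  \<open>V\<close> lies on one side of the orbit point, first replace \<open>V\<close> by the complement of its supremum or
  infimum, which \<open>H\<close> fixes). Then \<open>H\<close> contains two bumps living in different gaps, and every conjugate of the
  first commutes with one of the two, which is impossible if \<open>H\<close> is isomorphic to \<open>F\<^sub>n\<close>.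
\<close>

section \<open>Density of \<open>Z[1/n]\<close> and pointwise calculus in
  \<open>F\<^sub>n\<close>\<close>

lemma Z_inverse_dense:
  fixes a b :: real
  assumes n: "2 \<le> n" and ab: "a < b"
  obtains z where "z \<in> Z_inverse n" "a < z" "z < b"
proof -
  obtain k where k: "(1 / real n) ^ k < b - a"
    using real_arch_pow_inv[of "b - a" "1 / real n"] n ab by auto
  \<comment> \<open>The first point of the grid of mesh \<open>1 / n ^ k\<close> strictly to the
    right of \<open>a\<close>; the mesh is smaller than \<open>b - a\<close>, so it falls before
    \<open>b\<close>.\<close>
  define z where "z = of_int (\<lfloor>a * real n ^ k\<rfloor> + 1) / real n ^ k"
  have pos: "real n ^ k > 0" using n by simp
  have "a * real n ^ k < of_int (\<lfloor>a * real n ^ k\<rfloor> + 1)" by linarith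
  then have 1: "a < z" unfolding z_def using pos by (simp add: field_simps)
  have "of_int (\<lfloor>a * real n ^ k\<rfloor> + 1) \<le> a * real n ^ k + 1" by linarith
  also have "\<dots> < b * real n ^ k"
    using k pos by (simp add: power_divide field_simps)
  finally have 2: "z < b" unfolding z_def using pos by (simp add: field_simps)
  show thesis
    using that[OF _ 1 2] unfolding z_def Z_inverse_def by blast
qed

text \<open>The locale is used with two parameters in the end: with the \<open>n\<close> of the
  abstract copy, for the commutation property, and with the \<open>m\<close> of the ambient group,
  for the dynamics of \<open>H\<close>.\<close>

locale thompson =
  fixes n :: nat and G (structure)
  assumes n2: "2 \<le> n"
  defines "G \<equiv> thompson_F n"
begin

sublocale group G
  unfolding G_def by (rule group_thompson_F[OF n2])

lemma apply_mult:
  assumes "f \<in> carrier G" "g \<in> carrier G" "z \<in> {0..1}"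
  shows "(f \<otimes> g) z = f (g z)"
proof -
  have "f \<in> Bij {0..1}" "g \<in> Bij {0..1}"
    using assms carrier_thompson_F_facts(1) unfolding G_def by blast+
  then have "(f \<otimes> g) = compose {0..1} f g"
    unfolding G_def by (simp add: thompson_F_def BijGroup_def)
  then show ?thesis using assms(3) by (simp add: compose_def)
qed

lemma apply_one: "z \<in> {0..1} \<Longrightarrow> \<one> z = z"
  by (simp add: G_def thompson_F_def BijGroup_def)

lemma apply_in: "f \<in> carrier G \<Longrightarrow> z \<in> {0..1} \<Longrightarrow> f z \<in> {0..1}"
  using carrier_thompson_F_facts(2)[of f n] bij_betwE unfolding G_def by blast

lemma apply_less_iff:
  "f \<in> carrier G \<Longrightarrow> y \<in> {0..1} \<Longrightarrow> z \<in> {0..1} \<Longrightarrow> f y < f z \<longleftrightarrow> y < z"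
  using carrier_thompson_F_facts(4)[of f n] strict_mono_on_less unfolding G_def by blast

lemma apply_eq_iff:
  assumes "f \<in> carrier G" "y \<in> {0..1}" "z \<in> {0..1}"
  shows "f y = f z \<longleftrightarrow> y = z"
  using apply_less_iff[OF assms] apply_less_iff[OF assms(1,3,2)] by linarith

lemma apply_inv:
  assumes "f \<in> carrier G" "z \<in> {0..1}"
  shows "(inv f) (f z) = z" "f ((inv f) z) = z"
  using assms apply_mult[of "inv f" f z] apply_mult[of f "inv f" z] apply_one by auto

lemma eqI:
  assumes "f \<in> carrier G" "g \<in> carrier G" "\<And>z. z \<in> {0..1} \<Longrightarrow> f z = g z"
  shows "f = g"
  using assms extensionalityI[of f "{0..1}" g] by (simp add: G_def carrier_thompson_F)

lemma neq_one_moves: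
  assumes "f \<in> carrier G" "f \<noteq> \<one>"
  obtains z where "z \<in> {0..1}" "f z \<noteq> z"
  using eqI[of f \<one>] assms apply_one by auto

lemma apply_0: "f \<in> carrier G \<Longrightarrow> f 0 = 0"
  using carrier_thompson_F_facts(3)[of f n] unfolding G_def by blast

lemma apply_1:
  assumes f: "f \<in> carrier G"
  shows "f 1 = 1"
proof (rule antisym)
  show "f 1 \<le> 1" using apply_in[OF f, of 1] by simp
  have "(inv f) 1 \<in> {0..1}" using apply_in[of "inv f" 1] f by simp
  then show "1 \<le> f 1"
    using apply_less_iff[OF f, of 1 "(inv f) 1"] apply_inv(2)[OF f, of 1] by auto
qed

lemma neq_one_moves_interior:
  assumes "f \<in> carrier G" "f \<noteq> \<one>"
  obtains z where "z \<in> {0<..<1}" "f z \<noteq> z"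
proof -
  obtain z where z: "z \<in> {0..1}" "f z \<noteq> z"
    using neq_one_moves[OF assms] .
  moreover have "z \<noteq> 0" "z \<noteq> 1"
    using z apply_0[OF assms(1)] apply_1[OF assms(1)] by auto
  ultimately show thesis by (intro that) auto
qed

lemma apply_in_interior:
  assumes "f \<in> carrier G" "z \<in> {0<..<1}"
  shows "f z \<in> {0<..<1}"
  using assms apply_less_iff[of f 0 z] apply_less_iff[of f z 1] apply_0[of f] apply_1[of f] by auto

lemma continuous_on_apply: "f \<in> carrier G \<Longrightarrow> continuous_on {0..1} f"
  unfolding G_def carrier_thompson_F homeomorphism_def by blast

section \<open>Elements with prescribed support, and their orbits\<close>

lemma bump_exists:
  assumes pq: "p \<in> Z_inverse n" "q \<in> Z_inverse n" "0 \<le> p" "p < q" "q \<le> 1"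
  obtains f where "f \<in> carrier G"
    "\<And>z. z \<in> {0..1} \<Longrightarrow> z \<notin> {p<..<q} \<Longrightarrow> f z = z"
    "\<And>z. z \<in> {p<..<q} \<Longrightarrow> z < f z"
proof -
  \<comment> \<open>The graph leaves \<open>p\<close> with slope \<open>n\<close>, runs parallel to
    the diagonal at height \<open>(n - 1) * d\<close>, and arrives at \<open>q\<close> with slope
    \<open>1 / n\<close>. Dividing by \<open>n ^ 2\<close> keeps \<open>d\<close> in
    \<open>Z[1/n]\<close> and makes room for the two outer pieces, of widths \<open>d\<close> and
    \<open>n * d\<close>. The max with \<open>x\<close> gives the identity outside the interval, and
    the max/min form yields continuity and strict monotonicity without gluing.\<close>
  define d where "d = (q - p) / real n ^ 2"
  define F where "F x = max x (min (p + n * (x - p)) (min (x + (real n - 1) * d) (q - (q - x) / n)))"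
    for x :: real
  have n: "real n \<ge> 2" using n2 by simp
  have d0: "d > 0" using pq n by (simp add: d_def)
  have dq: "d * real n ^ 2 = q - p" using n by (simp add: d_def)
  have "2 * real n \<le> real n * real n" using n by (intro mult_right_mono) auto
  then have "real n + 1 \<le> real n ^ 2" using n unfolding power2_eq_square by linarith
  then have nd: "(real n + 1) * d \<le> q - p"
    using d0 mult_right_mono[of "real n + 1" "real n ^ 2" d] dq by (simp add: mult.commute)
  have d_Z: "d \<in> Z_inverse n"
  proof -
    have "q + - p \<in> Z_inverse n" by (intro Z_inverse_add[OF n2] Z_inverse_uminus pq)
    from Z_inverse_powi[OF n2 this, of "-2"] show ?thesis
      by (simp add: d_def power_int_minus field_simps)
  qed
  have nd_Z: "real n * d \<in> Z_inverse n"
    using Z_inverse_powi[OF n2 d_Z, of 1] by simp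
  let ?B = "{p, p + d, q + - (n * d), q}"
  have B: "?B \<subseteq> Z_inverse n"
  proof -
    have "p + d \<in> Z_inverse n" "q + - (n * d) \<in> Z_inverse n"
      by (intro Z_inverse_add[OF n2] Z_inverse_uminus pq d_Z nd_Z)+
    then show ?thesis using pq(1,2) by simp
  qed
  have slope_n: "n * (x - p) \<ge> x - p \<longleftrightarrow> x \<ge> p" for x
  proof -
    have "(x - p) * (real n - 1) \<ge> 0 \<longleftrightarrow> x \<ge> p"
      using n by (simp add: zero_le_mult_iff)
    then show ?thesis by (simp add: algebra_simps)
  qed
  have slope_inv: "(q - x) / n \<le> q - x \<longleftrightarrow> x \<le> q" for x
  proof -
    have "(q - x) * (real n - 1) \<ge> 0 \<longleftrightarrow> x \<le> q"
      using n by (simp add: zero_le_mult_iff)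
    then show ?thesis using n by (simp add: field_simps)
  qed
  \<comment> \<open>\<open>first\<close> and \<open>last\<close> locate the inner breakpoints, where
    the steep and the flat line cross the translation; \<open>mid\<close> below puts them in
    order.\<close>
  have first: "n * (x - p) \<le> (x - p) + (real n - 1) * d \<longleftrightarrow> x \<le> p + d" for x
  proof -
    have "(real n - 1) * (x - p) \<le> (real n - 1) * d \<longleftrightarrow> x \<le> p + d"
      using n by (auto simp: mult_le_cancel_left)
    then show ?thesis by (simp add: algebra_simps)
  qed
  have last: "x + (real n - 1) * d \<le> q - (q - x) / n \<longleftrightarrow> x \<le> q - n * d" for x
  proof -
    have "(real n - 1) * (n * d) \<le> (real n - 1) * (q - x) \<longleftrightarrow> x \<le> q - n * d"
      using n by (auto simp: mult_le_cancel_left)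
    then show ?thesis using n by (simp add: field_simps)
  qed
  have mid: "p + d \<le> q - n * d" using nd by (simp add: algebra_simps)
  have nd0: "n * d > 0" "(real n - 1) * d > 0" using n d0 by auto
  have F_out: "F x = x" if "x \<le> p \<or> q \<le> x" for x
  proof -
    have "p + n * (x - p) \<le> x" if "x \<le> p"
      by (cases "x = p", simp, use that slope_n[of x] in linarith)
    moreover have "q - (q - x) / n \<le> x" if "q \<le> x"
      by (cases "x = q", simp, use that slope_inv[of x] in linarith)
    ultimately have "p + n * (x - p) \<le> x \<or> q - (q - x) / n \<le> x"
      using that by blast
    then show ?thesis unfolding F_def by linarith
  qed
  have F_1: "F x = p + n * (x - p)" if "p \<le> x" "x \<le> p + d" for x
    using that slope_n[of x] first[of x] last[of x] mid nd0 unfolding F_def by linarith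
  have F_2: "F x = x + (real n - 1) * d" if "p + d \<le> x" "x \<le> q - n * d" for x
  proof -
    have "x + (real n - 1) * d \<le> p + n * (x - p)"
      using first[of x] that by (cases "x = p + d") (auto simp: algebra_simps)
    then show ?thesis using that last[of x] nd0 unfolding F_def by linarith
  qed
  have F_3: "F x = q - (q - x) / n" if "q - n * d \<le> x" "x \<le> q" for x
  proof -
    have "q - (q - x) / n \<le> x + (real n - 1) * d"
      using last[of x] that n by (cases "x = q - n * d") (auto simp: field_simps)
    moreover have "x + (real n - 1) * d \<le> p + n * (x - p)"
      using first[of x] that mid by (cases "x = p + d") (auto simp: algebra_simps)
    ultimately show ?thesis using that slope_inv[of x] unfolding F_def by linarith
  qed
  have F_mono: "F x < F y" if "x < y" for x y
  proof -
    have "n * (x - p) < n * (y - p)" "(q - y) / n < (q - x) / n"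
      using that n by (auto simp: divide_strict_right_mono)
    then show ?thesis using that unfolding F_def by linarith
  qed
  have F_gt: "x < F x" if "p < x" "x < q" for x
  proof -
    have "1 * (x - p) < n * (x - p)" "1 * (q - x) < n * (q - x)"
      using that n by (intro mult_strict_right_mono; simp)+
    then have "x - p < n * (x - p)" "(q - x) / n < q - x"
      using n by (simp_all add: pos_divide_less_eq mult.commute)
    then show ?thesis using nd0 unfolding F_def by linarith
  qed
  define f where "f = restrict F {0..1}"
  have cont: "continuous_on {0..1} F"
    unfolding F_def by (intro continuous_intros) (use n in auto)
  have F0: "F 0 = 0" "F 1 = 1" using F_out pq by auto
  have "F ` {0..1} = {0..1}"
  proof (intro equalityI subsetI)
    fix y assume "y \<in> F ` {0..1}"
    then obtain x where x: "x \<in> {0..1}" "y = F x" by blast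
    have "F 0 \<le> F x" "F x \<le> F 1"
      using F_mono[of 0 x] F_mono[of x 1] x by (cases "x = 0"; cases "x = 1"; force)+
    then show "y \<in> {0..1}" using x F0 by simp
  next
    fix y :: real assume "y \<in> {0..1}"
    then show "y \<in> F ` {0..1}"
      using IVT'[of F 0 y 1] cont F0 by force
  qed
  moreover have "inj_on F {0..1}"
    using F_mono by (intro strict_mono_imp_inj_on strict_monoI)
  ultimately obtain g where "homeomorphism {0..1} {0..1} F g"
    using homeomorphism_compact[OF compact_Icc cont] by blast
  then have "homeomorphism {0..1} {0..1} f g"
    by (rule homeomorphism_cong) (auto simp: f_def)
  moreover have "strict_mono_on {0..1} f"
    using F_mono by (auto simp: strict_mono_on_def f_def)
  moreover have "PL_adic n f"
  proof (rule PL_adicI[OF _ B])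
    fix a b :: real
    assume ab: "0 \<le> a" "a < b" "b \<le> 1" and gap: "{a<..<b} \<inter> ?B = {}"
    have off: "s \<le> a \<or> b \<le> s" if "s \<in> ?B" for s
      using gap that by force
    have fF: "f x = F x" if "x \<in> {a..b}" for x
      using that ab by (simp add: f_def)
    consider "b \<le> p \<or> q \<le> a" | "p \<le> a" "b \<le> p + d"
      | "p + d \<le> a" "b \<le> q - n * d" | "q - n * d \<le> a" "b \<le> q"
      using off[of p] off[of "p + d"] off[of "q + - (n * d)"] off[of q] by auto
    then show "\<exists>(k::int) c. \<forall>x\<in>{a..b}. f x = real n powi k * x + c"
    proof cases
      case 1
      then show ?thesis using fF F_out by (intro exI[of _ 0]) (auto intro!: exI[of _ 0])
    next
      case 2
      then have "f x = real n powi 1 * x + (p - n * p)" if "x \<in> {a..b}" for x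
        using fF[OF that] F_1[of x] that by (simp add: algebra_simps)
      then show ?thesis by blast
    next
      case 3
      then have "f x = real n powi 0 * x + (real n - 1) * d" if "x \<in> {a..b}" for x
        using fF[OF that] F_2[of x] that by simp
      then show ?thesis by blast
    next
      case 4
      then have "f x = real n powi (-1) * x + (q - q / n)" if "x \<in> {a..b}" for x
        using fF[OF that] F_3[of x] that n by (simp add: power_int_minus field_simps)
      then show ?thesis by blast
    qed
  qed simp
  ultimately have "f \<in> carrier G"
    unfolding G_def carrier_thompson_F by (auto simp: f_def)
  then show thesis
    by (rule that) (use pq F_out F_gt in \<open>auto simp: f_def not_less\<close>)
qed

text \<open>Frees bumps from endpoints in \<open>Z[1/n]\<close>: density supplies admissible
  endpoints inside any real interval, at the price of guaranteeing movement at only one point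
  \<open>w\<close>.\<close>

lemma small_bump_exists:
  assumes lr: "0 \<le> l" "l < r" "r \<le> 1"
  obtains f w where "f \<in> carrier G" "\<And>z. z \<in> {0..1} \<Longrightarrow> z \<le> f z"
    "\<And>z. z \<in> {0..1} \<Longrightarrow> z \<notin> {l<..<r} \<Longrightarrow> f z = z" "w \<in> {l<..<r}" "w < f w"
proof -
  obtain q where q: "q \<in> Z_inverse n" "l < q" "q < r"
    using Z_inverse_dense[OF n2 lr(2)] .
  obtain p where p: "p \<in> Z_inverse n" "l < p" "p < q"
    using Z_inverse_dense[OF n2 q(2)] .
  have pq: "0 \<le> p" "q \<le> 1" using p q lr by auto
  obtain f where f: "f \<in> carrier G"
    and f_out: "\<And>z. z \<in> {0..1} \<Longrightarrow> z \<notin> {p<..<q} \<Longrightarrow> f z = z"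
    and f_gt: "\<And>z. z \<in> {p<..<q} \<Longrightarrow> z < f z"
    using bump_exists[OF p(1) q(1) pq(1) p(3) pq(2)] by blast
  show thesis
  proof (rule that[OF f, of "(p + q) / 2"])
    show "z \<le> f z" if "z \<in> {0..1}" for z
      using f_out[OF that] f_gt[of z] by fastforce
    show "f z = z" if "z \<in> {0..1}" "z \<notin> {l<..<r}" for z
      using f_out[OF that(1)] that(2) p q by auto
    show "(p + q) / 2 < f ((p + q) / 2)" using f_gt[of "(p + q) / 2"] p by auto
    show "(p + q) / 2 \<in> {l<..<r}" using p q by auto
  qed
qed

text \<open>The orbit of \<open>x\<close> under the elements supported in \<open>{p<..<q}\<close>
  accumulates at both ends. An extremum of the orbit inside the interval would be overshot by
  applying a bump, or its inverse, to a nearby orbit point.\<close>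

lemma push_to_ends:
  assumes pq: "p \<in> Z_inverse n" "q \<in> Z_inverse n" "0 \<le> p" "q \<le> 1"
    and x: "p < x" "x < q" and t: "p < t" "t < q"
  shows "\<exists>h\<in>carrier G. (\<forall>z\<in>{0..1} - {p<..<q}. h z = z) \<and> t < h x \<and> h x < q"
    and "\<exists>h\<in>carrier G. (\<forall>z\<in>{0..1} - {p<..<q}. h z = z) \<and> p < h x \<and> h x < t"
proof -
  have plq: "p < q" using x by simp
  obtain f where f: "f \<in> carrier G"
    and f_out: "\<And>z. z \<in> {0..1} \<Longrightarrow> z \<notin> {p<..<q} \<Longrightarrow> f z = z"
    and f_gt: "\<And>z. z \<in> {p<..<q} \<Longrightarrow> z < f z"
    using bump_exists[OF pq(1,2,3) plq pq(4)] by blast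
  \<comment> \<open>\<open>T\<close> collects the elements supported in the interval, and
    \<open>S\<close> is the orbit of \<open>x\<close> under \<open>T\<close>.\<close>
  define T where "T = {h \<in> carrier G. \<forall>z\<in>{0..1} - {p<..<q}. h z = z}"
  define S where "S = (\<lambda>h. h x) ` T"
  have sub: "{p<..<q} \<subseteq> {0..1}" using pq by auto
  have T_in: "h y \<in> {p<..<q}" if h: "h \<in> T" and y: "y \<in> {p<..<q}" for h y
  proof -
    have "h p = p" "h q = q" "h \<in> carrier G"
      using h pq plq by (auto simp: T_def)
    then show ?thesis
      using apply_less_iff[of h p y] apply_less_iff[of h y q] y pq by auto
  qed
  have f_T: "f \<in> T" using f f_out by (auto simp: T_def)
  have inv_out: "(inv f) z = z" if "z \<in> {0..1}" "z \<notin> {p<..<q}" for z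
    using apply_inv(1)[OF f that(1)] f_out[OF that] by simp
  have inv_T: "inv f \<in> T" using f inv_out by (auto simp: T_def)
  have mult_T: "g \<otimes> h \<in> T" if "g \<in> T" "h \<in> T" for g h
    using that by (auto simp: T_def apply_mult)
  have mult_S: "g y \<in> S" if "g \<in> T" "y \<in> S" for g y
  proof -
    obtain h where h: "h \<in> T" "y = h x" using \<open>y \<in> S\<close> S_def by blast
    have "(g \<otimes> h) x = g y"
      using that h apply_mult[of g h x] x pq by (auto simp: T_def)
    then show ?thesis
      unfolding S_def using mult_T[OF that(1) h(1)] by (intro image_eqI[of _ _ "g \<otimes> h"]) auto
  qed
  have S_sub: "S \<subseteq> {p<..<q}" using T_in x by (auto simp: S_def)
  have "\<one> x = x" using x pq by (intro apply_one) auto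
  then have xS: "x \<in> S" unfolding S_def T_def
    by (intro image_eqI[of _ _ \<one>]) (auto simp: apply_one)
  have bdd: "bdd_above S" "bdd_below S"
    using S_sub by (meson bdd_above_Ioo bdd_above_mono, meson bdd_below_Ioo bdd_below_mono)
  have "\<exists>y\<in>S. t < y"
  proof (rule ccontr)
    assume "\<not> ?thesis"
    then have le: "\<And>y. y \<in> S \<Longrightarrow> y \<le> t" by force
    define s where "s = Sup S"
    have "s \<le> t" unfolding s_def using le xS by (intro cSup_least) auto
    moreover have "x \<le> s" unfolding s_def using xS bdd by (intro cSup_upper)
    ultimately have s: "s \<in> {p<..<q}" using x t by auto
    \<comment> \<open>Since \<open>f\<close> sends \<open>u\<close> to \<open>s\<close>, any orbit
      point beyond \<open>u\<close> is sent beyond the supremum.\<close>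
    define u where "u = (inv f) s"
    have u: "u \<in> {p<..<q}" unfolding u_def by (rule T_in[OF inv_T s])
    have fu: "f u = s" unfolding u_def using s sub by (intro apply_inv(2)[OF f]) auto
    have "u < s" using f_gt[OF u] fu by simp
    then obtain y where y: "y \<in> S" "u < y"
      unfolding s_def using less_cSup_iff[of S u] xS bdd by auto
    have "s < f y" using apply_less_iff[OF f, of u y] y S_sub u sub fu by blast
    moreover have "f y \<le> s"
      unfolding s_def using mult_S[OF f_T y(1)] bdd by (intro cSup_upper)
    ultimately show False by simp
  qed
  then obtain h where "h \<in> T" "t < h x" unfolding S_def by blast
  moreover from this have "h x < q" using T_in x by simp
  ultimately show "\<exists>h\<in>carrier G. (\<forall>z\<in>{0..1} - {p<..<q}. h z = z) \<and> t < h x \<and> h x < q"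
    unfolding T_def by blast
  have "\<exists>y\<in>S. y < t"
  proof (rule ccontr)
    assume "\<not> ?thesis"
    then have le: "\<And>y. y \<in> S \<Longrightarrow> t \<le> y" by force
    define s where "s = Inf S"
    have "t \<le> s" unfolding s_def using le xS by (intro cInf_greatest) auto
    moreover have "s \<le> x" unfolding s_def using xS bdd by (intro cInf_lower)
    ultimately have s: "s \<in> {p<..<q}" using x t by auto
    \<comment> \<open>Mirror image: an orbit point below \<open>f s\<close> is sent by
      \<open>inv f\<close> below the infimum.\<close>
    have "s < f s" using f_gt s by blast
    then obtain y where y: "y \<in> S" "y < f s"
      unfolding s_def using cInf_less_iff[of S] xS bdd by auto
    have y': "y \<in> {0..1}" "(inv f) y \<in> {0..1}"
      using y S_sub sub mult_S[OF inv_T y(1)] by blast+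
    have "(inv f) y < s"
      using apply_less_iff[OF f y'(2), of s] apply_inv(2)[OF f y'(1)] y s sub by auto
    moreover have "s \<le> (inv f) y"
      unfolding s_def using mult_S[OF inv_T y(1)] bdd by (intro cInf_lower)
    ultimately show False by simp
  qed
  then obtain h where "h \<in> T" "h x < t" unfolding S_def by blast
  moreover from this have "p < h x" using T_in x by simp
  ultimately show "\<exists>h\<in>carrier G. (\<forall>z\<in>{0..1} - {p<..<q}. h z = z) \<and> p < h x \<and> h x < t"
    unfolding T_def by blast
qed

text \<open>Pushing \<open>x\<close> towards an endpoint in \<open>Z[1/n]\<close> that lies inside
  the target \<open>{u<..<v}\<close>, with the far side of the target as threshold, lands
  \<open>x\<close> between the two.\<close>

lemma dense_orbits_supported:
  assumes lr: "0 \<le> l" "r \<le> 1" and x: "l < x" "x < r" and uv: "l \<le> u" "u < v" "v \<le> r"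
  obtains h where "h \<in> carrier G" "\<And>z. z \<in> {0..1} \<Longrightarrow> z \<notin> {l<..<r} \<Longrightarrow> h z = z"
    "h x \<in> {u<..<v}"
proof -
  consider "u < x" "x < v" | "x \<le> u" | "v \<le> x" by linarith
  then show thesis
  proof cases
    case 1
    then show thesis
      using that[of \<one>] x lr by (auto simp: apply_one)
  next
    case 2
    obtain q where q: "q \<in> Z_inverse n" "u < q" "q < v" using Z_inverse_dense[OF n2 uv(2)] .
    obtain p where p: "p \<in> Z_inverse n" "l < p" "p < x" using Z_inverse_dense[OF n2 x(1)] .
    obtain h where "h \<in> carrier G" "\<forall>z\<in>{0..1} - {p<..<q}. h z = z" "u < h x" "h x < q"
      using push_to_ends(1)[OF p(1) q(1), of x u] p q uv 2 lr by auto
    then show thesis using p q uv by (intro that[of h]) auto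
  next
    case 3
    obtain p where p: "p \<in> Z_inverse n" "u < p" "p < v" using Z_inverse_dense[OF n2 uv(2)] .
    obtain q where q: "q \<in> Z_inverse n" "x < q" "q < r" using Z_inverse_dense[OF n2 x(2)] .
    obtain h where "h \<in> carrier G" "\<forall>z\<in>{0..1} - {p<..<q}. h z = z" "p < h x" "h x < v"
      using push_to_ends(2)[OF p(1) q(1), of x v] p q uv 3 lr by auto
    then show thesis using p q uv by (intro that[of h]) auto
  qed
qed

section \<open>Displaced neighbourhoods and perturbation of commuting pairs\<close>

lemma displaces_nbhd:
  assumes f: "f \<in> carrier G" and x: "x \<in> {0<..<1}" "f x \<noteq> x"
  obtains e where "e > 0" "{x - e..x + e} \<subseteq> {0<..<1}"
    "\<And>y z. y \<in> {x - e..x + e} \<Longrightarrow> z \<in> {x - e..x + e} \<Longrightarrow> f y \<noteq> z"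
proof -
  define \<delta> where "\<delta> = \<bar>f x - x\<bar>"
  have \<delta>: "\<delta> > 0" using x by (simp add: \<delta>_def)
  have "isCont f x"
    using continuous_on_interior[OF continuous_on_apply[OF f]] x by simp
  then obtain s where s: "s > 0" "\<And>y. dist y x < s \<Longrightarrow> dist (f y) (f x) < \<delta> / 2"
    unfolding continuous_at_eps_delta using \<delta> by (metis half_gt_zero)
  \<comment> \<open>The displacement \<open>\<delta>\<close> is split in half: \<open>f y\<close>
    stays strictly within \<open>\<delta> / 2\<close> of \<open>f x\<close>, and \<open>z\<close>
    within \<open>\<delta> / 2\<close> of \<open>x\<close>, so they cannot meet. The last two terms
    keep the neighbourhood inside the open interval.\<close>
  define e where "e = min (min (s / 2) (\<delta> / 2)) (min (x / 2) ((1 - x) / 2))"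
  have "e > 0" using s(1) \<delta> x by (simp add: e_def)
  moreover have "e \<le> s / 2" "e \<le> \<delta> / 2" "e \<le> x / 2" "e \<le> (1 - x) / 2"
    unfolding e_def by linarith+
  ultimately have e: "e > 0" "e < s" "e \<le> \<delta> / 2" "e < x" "e < 1 - x"
    using s(1) x by auto
  show thesis
  proof (rule that[OF e(1)])
    show "{x - e..x + e} \<subseteq> {0<..<1}" using e by auto
    show "f y \<noteq> z" if "y \<in> {x - e..x + e}" "z \<in> {x - e..x + e}" for y z
    proof -
      have "\<bar>f y - f x\<bar> < \<delta> / 2" using s(2)[of y] that e by (auto simp: dist_real_def)
      moreover have "\<bar>z - x\<bar> \<le> \<delta> / 2"
        using that(2) e unfolding atLeastAtMost_iff by linarith
      moreover have "\<delta> \<le> \<bar>f y - f x\<bar> + \<bar>z - x\<bar>" if "f y = z"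
        using that unfolding \<delta>_def by linarith
      ultimately show ?thesis by fastforce
    qed
  qed
qed

lemma apply_conj:
  assumes "h \<in> carrier G" "a \<in> carrier G" "z \<in> {0..1}"
  shows "(h \<otimes> a \<otimes> inv h) z = h (a ((inv h) z))"
  using assms apply_in[of "inv h" z] by (simp add: apply_mult)

lemma inv_fixes:
  assumes "h \<in> carrier G" "z \<in> {0..1}" "h z = z"
  shows "(inv h) z = z"
  using apply_inv(1)[OF assms(1,2)] assms(3) by simp

text \<open>This is what allows successive perturbations: a conjugator that fixes the finitely many
  points witnessing an inequality leaves that inequality intact.\<close>

lemma conj_fixes:
  assumes "h \<in> carrier G" "c \<in> carrier G" "z \<in> {0..1}" "h z = z" "h (c z) = c z"
  shows "(h \<otimes> c \<otimes> inv h) z = c z"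
  using assms by (simp add: apply_conj inv_fixes)

text \<open>
  If \<open>c\<close> and \<open>a\<close> commute, conjugate \<open>c\<close> by a bump \<open>h\<close> on an interval \<open>I\<close> disjoint from
  \<open>c ` I\<close> and \<open>a ` I\<close>. Commutation of the conjugate with \<open>a\<close> would give
  \<open>h (c (a v)) = c (a (h\<inverse> v))\<close> for \<open>v\<close> in \<open>I\<close>, but the left side is at least \<open>c (a v)\<close> and the
  right side is smaller.
\<close>

lemma perturb_noncommuting:
  assumes c: "c \<in> carrier G" and a: "a \<in> carrier G"
    and x: "x \<in> {0<..<1}" "c x \<noteq> x" "a x \<noteq> x" and S: "finite S"
  obtains h where "h \<in> carrier G" "\<And>z. z \<in> S \<inter> {0..1} \<Longrightarrow> h z = z"
    "(h \<otimes> c \<otimes> inv h) \<otimes> a \<noteq> a \<otimes> (h \<otimes> c \<otimes> inv h)"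
proof (cases "c \<otimes> a = a \<otimes> c")
  case False
  show thesis
    by (rule that[of \<one>]) (use False c in \<open>auto simp: apply_one\<close>)
next
  case True
  obtain e1 where e1: "e1 > 0" "{x - e1..x + e1} \<subseteq> {0<..<1}"
    "\<And>y z. y \<in> {x - e1..x + e1} \<Longrightarrow> z \<in> {x - e1..x + e1} \<Longrightarrow> c y \<noteq> z"
    using displaces_nbhd[OF c x(1,2)] by blast
  obtain e2 where e2: "e2 > 0" "{x - e2..x + e2} \<subseteq> {0<..<1}"
    "\<And>y z. y \<in> {x - e2..x + e2} \<Longrightarrow> z \<in> {x - e2..x + e2} \<Longrightarrow> a y \<noteq> z"
    using displaces_nbhd[OF a x(1,3)] by blast
  obtain d where d: "d > 0" "\<And>s. s \<in> S \<Longrightarrow> s \<noteq> x \<Longrightarrow> d \<le> dist x s"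
    using finite_set_avoid[OF S, of x] by blast
  \<comment> \<open>The open interval \<open>I\<close> starts at \<open>x\<close>, so it misses
    \<open>x\<close> even when \<open>x\<close> is in \<open>S\<close>; its width keeps it clear of
    the other points of \<open>S\<close> and inside both displaced neighbourhoods.\<close>
  define r where "r = x + min d (min e1 e2)"
  define I where "I = {x<..<r}"
  have xr: "x < r" using e1(1) e2(1) d(1) by (simp add: r_def)
  have I1: "I \<subseteq> {x - e1..x + e1}" and I2: "I \<subseteq> {x - e2..x + e2}"
    using e1(1) e2(1) by (auto simp: I_def r_def)
  have I01: "I \<subseteq> {0..1}" using I1 e1(2) by force
  have "r \<in> {x - e1..x + e1}" using e1(1) xr by (auto simp: r_def)
  then have r1: "r \<le> 1" using e1(2) by fastforce
  have x0: "0 \<le> x" using x(1) by simp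
  have IS: "s \<notin> I" if "s \<in> S" for s
    using d(2)[OF that] by (force simp: I_def r_def dist_real_def)
  obtain h w where h: "h \<in> carrier G" and h_ge: "\<And>z. z \<in> {0..1} \<Longrightarrow> z \<le> h z"
    and h_out: "\<And>z. z \<in> {0..1} \<Longrightarrow> z \<notin> I \<Longrightarrow> h z = z"
    and w: "w \<in> I" "w < h w"
    unfolding I_def using small_bump_exists[OF x0 xr r1] by blast
  \<comment> \<open>Both products are evaluated at \<open>v\<close>, whose preimage \<open>w\<close>
    under \<open>h\<close> lies strictly to its left, with both points in \<open>I\<close>.\<close>
  define v where "v = h w"
  have w01: "w \<in> {0..1}" using w I01 by blast
  have "r \<in> {0..1}" "h r = r" using h_out[of r] r1 xr x by (auto simp: I_def)
  then have "h w < r" using apply_less_iff[OF h w01, of r] w by (auto simp: I_def)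
  then have v: "v \<in> I" using w by (auto simp: v_def I_def)
  have v01: "v \<in> {0..1}" using v I01 by blast
  have inv_v: "(inv h) v = w" unfolding v_def by (rule apply_inv(1)[OF h w01])
  have av: "a v \<notin> I" "c w \<notin> I"
    using e1(3)[of w "c w"] e2(3)[of v "a v"] I1 I2 v w by blast+
  let ?c = "h \<otimes> c \<otimes> inv h"
  have ca: "c (a z) = a (c z)" if "z \<in> {0..1}" for z
    using True that apply_mult[OF a c that] apply_mult[OF c a that] by simp
  have "?c \<otimes> a \<noteq> a \<otimes> ?c"
  proof
    assume eq: "?c \<otimes> a = a \<otimes> ?c"
    \<comment> \<open>As \<open>a v\<close> and \<open>c w\<close> are off \<open>I\<close>,
      \<open>inv h\<close> fixes the former and \<open>h\<close> the latter, which removes one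
      factor from each side.\<close>
    have "(?c \<otimes> a) v = h (c (a v))"
      using h c a v01 av(1) apply_in[OF a v01]
      by (simp add: apply_mult apply_conj inv_fixes h_out del: atLeastAtMost_iff)
    moreover have "(a \<otimes> ?c) v = a (c w)"
      using h c a v01 w01 av(2) apply_in[OF c w01]
      by (simp add: apply_mult apply_conj inv_v h_out del: atLeastAtMost_iff)
    ultimately have "h (c (a v)) = c (a w)" using eq ca[OF w01] by simp
    moreover have "c (a v) \<le> h (c (a v))"
      by (intro h_ge apply_in[OF c] apply_in[OF a] v01)
    moreover have "c (a w) < c (a v)"
      using w(2) by (simp add: apply_less_iff[OF c] apply_less_iff[OF a] apply_in[OF a]
          w01 v01 v_def[symmetric] del: atLeastAtMost_iff)
    ultimately show False by simp
  qed
  then show thesis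
    by (intro that[OF h]) (use IS h_out in auto)
qed

end

section \<open>A commutation property invariant under isomorphism\<close>

text \<open>Phrased by multiplication alone, without supports, because the isomorphism between
  \<open>H\<close> and \<open>F\<^sub>n\<close> is abstract and need not respect the action on the
  interval.\<close>

definition conj_entangling :: "('a, 'b) monoid_scheme \<Rightarrow> bool" where
  "conj_entangling G \<longleftrightarrow>
     (\<forall>a\<in>carrier G - {\<one>\<^bsub>G\<^esub>}. \<forall>b\<in>carrier G - {\<one>\<^bsub>G\<^esub>}. \<exists>h\<in>carrier G.
        let c = h \<otimes>\<^bsub>G\<^esub> a \<otimes>\<^bsub>G\<^esub> inv\<^bsub>G\<^esub> h
        in c \<otimes>\<^bsub>G\<^esub> a \<noteq> a \<otimes>\<^bsub>G\<^esub> c \<and> c \<otimes>\<^bsub>G\<^esub> b \<noteq> b \<otimes>\<^bsub>G\<^esub> c)"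

text \<open>Injectivity keeps \<open>\<phi> a\<close> and \<open>\<phi> b\<close> nontrivial,
  surjectivity pulls the conjugator back, and a homomorphism cannot make a commuting pair
  noncommuting.\<close>

lemma conj_entangling_iso:
  assumes G: "group G" and K: "group K" and iso: "G \<cong> K" and ent: "conj_entangling K"
  shows "conj_entangling G"
  unfolding conj_entangling_def
proof (intro ballI)
  fix a b
  assume a: "a \<in> carrier G - {\<one>\<^bsub>G\<^esub>}" and b: "b \<in> carrier G - {\<one>\<^bsub>G\<^esub>}"
  obtain \<phi> where \<phi>: "\<phi> \<in> hom G K" "bij_betw \<phi> (carrier G) (carrier K)"
    using iso by (auto simp: is_iso_def iso_def)
  interpret \<phi>: group_hom G K \<phi>
    using G K \<phi>(1) by (simp add: group_hom_def group_hom_axioms_def)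
  have inj: "inj_on \<phi> (carrier G)" using \<phi>(2) by (simp add: bij_betw_def)
  have nt: "\<phi> y \<in> carrier K - {\<one>\<^bsub>K\<^esub>}" if "y \<in> carrier G - {\<one>\<^bsub>G\<^esub>}" for y
    using that inj \<phi>.hom_one by (auto simp: inj_on_def)
  obtain k where k: "k \<in> carrier K"
    "let c = k \<otimes>\<^bsub>K\<^esub> \<phi> a \<otimes>\<^bsub>K\<^esub> inv\<^bsub>K\<^esub> k
     in c \<otimes>\<^bsub>K\<^esub> \<phi> a \<noteq> \<phi> a \<otimes>\<^bsub>K\<^esub> c \<and> c \<otimes>\<^bsub>K\<^esub> \<phi> b \<noteq> \<phi> b \<otimes>\<^bsub>K\<^esub> c"
    using ent nt[OF a] nt[OF b] unfolding conj_entangling_def by blast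
  obtain h where h: "h \<in> carrier G" "k = \<phi> h"
    using k(1) \<phi>(2) by (auto simp: bij_betw_def)
  define c where "c = h \<otimes>\<^bsub>G\<^esub> a \<otimes>\<^bsub>G\<^esub> inv\<^bsub>G\<^esub> h"
  have c: "c \<in> carrier G" "\<phi> c = k \<otimes>\<^bsub>K\<^esub> \<phi> a \<otimes>\<^bsub>K\<^esub> inv\<^bsub>K\<^esub> k"
    using h a by (auto simp: c_def)
  have "c \<otimes>\<^bsub>G\<^esub> y \<noteq> y \<otimes>\<^bsub>G\<^esub> c"
    if "y \<in> carrier G" "\<phi> c \<otimes>\<^bsub>K\<^esub> \<phi> y \<noteq> \<phi> y \<otimes>\<^bsub>K\<^esub> \<phi> c" for y
    using that c(1) \<phi>.hom_mult by metis
  then show "\<exists>h\<in>carrier G.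
        let c = h \<otimes>\<^bsub>G\<^esub> a \<otimes>\<^bsub>G\<^esub> inv\<^bsub>G\<^esub> h
        in c \<otimes>\<^bsub>G\<^esub> a \<noteq> a \<otimes>\<^bsub>G\<^esub> c \<and> c \<otimes>\<^bsub>G\<^esub> b \<noteq> b \<otimes>\<^bsub>G\<^esub> c"
    using k(2) a b h(1) unfolding Let_def c(2)[symmetric] c_def[symmetric]
    by (intro bexI[of _ h]) (auto simp: c_def[symmetric])
qed

context thompson
begin

text \<open>The support of the conjugate is the image under \<open>h\<close> of the support of
  \<open>a\<close>. So \<open>h\<close> fixes one point \<open>x\<close> moved by \<open>a\<close>
  and carries a second such point, close to \<open>x\<close>, to a point moved by
  \<open>b\<close>.\<close>

lemma conj_support_meets_both:
  assumes a: "a \<in> carrier G" "a \<noteq> \<one>" and b: "b \<in> carrier G" "b \<noteq> \<one>"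
  obtains h x y where "h \<in> carrier G" "x \<in> {0<..<1}" "y \<in> {0<..<1}"
    "(h \<otimes> a \<otimes> inv h) x \<noteq> x" "a x \<noteq> x" "(h \<otimes> a \<otimes> inv h) y \<noteq> y" "b y \<noteq> y"
proof -
  obtain x where x: "x \<in> {0<..<1}" "a x \<noteq> x" by (rule neq_one_moves_interior[OF a])
  obtain e where e: "e > 0" "{x - e..x + e} \<subseteq> {0<..<1}"
    "\<And>y z. y \<in> {x - e..x + e} \<Longrightarrow> z \<in> {x - e..x + e} \<Longrightarrow> a y \<noteq> z"
    using displaces_nbhd[OF a(1) x] by blast
  obtain y where y: "y \<in> {0<..<1}" "b y \<noteq> y" by (rule neq_one_moves_interior[OF b])
  obtain d where d: "d > 0" "{y - d..y + d} \<subseteq> {0<..<1}"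
    "\<And>u z. u \<in> {y - d..y + d} \<Longrightarrow> z \<in> {y - d..y + d} \<Longrightarrow> b u \<noteq> z"
    using displaces_nbhd[OF b(1) y] by blast
  have ends: "x - e > 0" "x + e < 1" "y - d > 0" "y + d < 1"
    using e(1) d(1) subsetD[OF e(2), of "x - e"] subsetD[OF e(2), of "x + e"]
      subsetD[OF d(2), of "y - d"] subsetD[OF d(2), of "y + d"] by auto
  \<comment> \<open>As \<open>h\<close> preserves order and fixes \<open>x\<close>, the second point
    is taken on the side of \<open>x\<close> where \<open>y\<close> lies, and \<open>h\<close> is
    supported on that side.\<close>
  have "\<exists>x1\<in>{x - e..x + e}. \<exists>h\<in>carrier G. h x = x \<and> h x1 \<in> {y - d..y + d}"
  proof (cases "x \<le> y")
    case True
    have *: "0 \<le> x" "x < x + e" "x + e < 1" "x \<le> y" "y < y + d" "y + d \<le> 1"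
      using x e(1) ends True d(1) by auto
    obtain h where "h \<in> carrier G" "\<And>z. z \<in> {0..1} \<Longrightarrow> z \<notin> {x<..<1} \<Longrightarrow> h z = z"
      "h (x + e) \<in> {y<..<y + d}"
      using dense_orbits_supported[OF *(1) order_refl *(2-6)] by blast
    then show ?thesis using x e(1) d(1) by (intro bexI[of _ "x + e"] bexI[of _ h]) auto
  next
    case False
    have *: "x \<le> 1" "0 < x - e" "x - e < x" "0 \<le> y - d" "y - d < y" "y \<le> x"
      using x e(1) ends False d(1) by auto
    obtain h where "h \<in> carrier G" "\<And>z. z \<in> {0..1} \<Longrightarrow> z \<notin> {0<..<x} \<Longrightarrow> h z = z"
      "h (x - e) \<in> {y - d<..<y}"
      using dense_orbits_supported[OF order_refl *] by blast
    then show ?thesis using x e(1) d(1) by (intro bexI[of _ "x - e"] bexI[of _ h]) auto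
  qed
  then obtain x1 h where x1: "x1 \<in> {x - e..x + e}" and h: "h \<in> carrier G" "h x = x"
    and hx1: "h x1 \<in> {y - d..y + d}" by blast
  have xI: "x \<in> {0..1}" "x1 \<in> {0..1}" "h x1 \<in> {0..1}"
    using x(1) subsetD[OF e(2) x1] subsetD[OF d(2) hx1] by auto
  have conj: "(h \<otimes> a \<otimes> inv h) (h z) \<noteq> h z" if "z \<in> {0..1}" "a z \<noteq> z" for z
    using that h(1) a(1) apply_in[OF h(1) that(1)] apply_in[OF a(1) that(1)]
    by (simp add: apply_conj apply_inv apply_eq_iff del: atLeastAtMost_iff)
  show thesis
  proof (rule that[OF h(1) x(1)])
    show "h x1 \<in> {0<..<1}" using hx1 d(2) by blast
    show "(h \<otimes> a \<otimes> inv h) x \<noteq> x" using conj[OF xI(1) x(2)] h(2) by simp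
    show "a x \<noteq> x" by (rule x(2))
    show "(h \<otimes> a \<otimes> inv h) (h x1) \<noteq> h x1"
      using conj[OF xI(2)] e(3)[OF x1 x1] by blast
    show "b (h x1) \<noteq> h x1" by (rule d(3)[OF hx1 hx1])
  qed
qed

lemma conj_conj:
  assumes "h \<in> carrier G" "k \<in> carrier G" "a \<in> carrier G"
  shows "h \<otimes> (k \<otimes> a \<otimes> inv k) \<otimes> inv h = (h \<otimes> k) \<otimes> a \<otimes> inv (h \<otimes> k)"
  using assms by (simp add: m_assoc inv_mult_group)

text \<open>After the supports have been made to meet, commutation with \<open>a\<close> and then
  with \<open>b\<close> is broken by two further conjugations, each protecting what is already
  achieved.\<close>

lemma conj_entangling: "conj_entangling G"
  unfolding conj_entangling_def
proof (intro ballI)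
  fix a b assume "a \<in> carrier G - {\<one>}" "b \<in> carrier G - {\<one>}"
  then have a: "a \<in> carrier G" "a \<noteq> \<one>" and b: "b \<in> carrier G" "b \<noteq> \<one>" by auto
  obtain h x y where h: "h \<in> carrier G" and x: "x \<in> {0<..<1}" "(h \<otimes> a \<otimes> inv h) x \<noteq> x" "a x \<noteq> x"
    and y: "y \<in> {0<..<1}" "(h \<otimes> a \<otimes> inv h) y \<noteq> y" "b y \<noteq> y"
    using conj_support_meets_both[OF a b] by metis
  define c where "c = h \<otimes> a \<otimes> inv h"
  have c: "c \<in> carrier G" using a h by (simp add: c_def)
  have yI: "y \<in> {0..1}" using y by auto
  \<comment> \<open>Fixing \<open>y\<close> and \<open>c y\<close> ensures that the new conjugate
    still moves \<open>y\<close>, as the step for \<open>b\<close> requires.\<close>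
  obtain k where k: "k \<in> carrier G" and k_fix: "\<And>z. z \<in> {y, c y} \<inter> {0..1} \<Longrightarrow> k z = z"
    and ka: "(k \<otimes> c \<otimes> inv k) \<otimes> a \<noteq> a \<otimes> (k \<otimes> c \<otimes> inv k)"
    using perturb_noncommuting[OF c a(1) x(1) _ x(3), of "{y, c y}"] x(2)
    by (auto simp: c_def)
  define c' where "c' = k \<otimes> c \<otimes> inv k"
  have c': "c' \<in> carrier G" using c k by (simp add: c'_def)
  have "c' y = c y"
    unfolding c'_def using k_fix yI apply_in[OF c yI] by (intro conj_fixes[OF k c yI]) auto
  then have c'y: "c' y \<noteq> y" using y(2) by (simp add: c_def)
  obtain z where z: "z \<in> {0..1}" "c' (a z) \<noteq> a (c' z)"
    using ka eqI[of "c' \<otimes> a" "a \<otimes> c'"] a(1) c' by (auto simp: c'_def[symmetric] apply_mult)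
  have zI: "a z \<in> {0..1}" "c' z \<in> {0..1}" "c' (a z) \<in> {0..1}"
    by (intro apply_in[OF a(1)] apply_in[OF c'] z(1))+
  \<comment> \<open>These four points determine both sides of
    \<open>c' (a z) \<noteq> a (c' z)\<close>; fixing them preserves noncommutation with
    \<open>a\<close>.\<close>
  define S where "S = {z, a z, c' z, c' (a z)}"
  obtain l where l: "l \<in> carrier G" and l_fix: "\<And>z. z \<in> S \<inter> {0..1} \<Longrightarrow> l z = z"
    and lb: "(l \<otimes> c' \<otimes> inv l) \<otimes> b \<noteq> b \<otimes> (l \<otimes> c' \<otimes> inv l)"
    using perturb_noncommuting[OF c' b(1) y(1) c'y y(3), of S] by (auto simp: S_def)
  define c'' where "c'' = l \<otimes> c' \<otimes> inv l"
  have c'': "c'' \<in> carrier G" using c' l by (simp add: c''_def)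
  have "l z = z" "l (a z) = a z" "l (c' z) = c' z" "l (c' (a z)) = c' (a z)"
    using l_fix z(1) zI by (auto simp: S_def)
  then have "c'' z = c' z" "c'' (a z) = c' (a z)"
    unfolding c''_def using conj_fixes[OF l c' z(1)] conj_fixes[OF l c' zI(1)] by auto
  then have "(c'' \<otimes> a) z \<noteq> (a \<otimes> c'') z"
    using z a(1) c'' by (simp add: apply_mult)
  then have "c'' \<otimes> a \<noteq> a \<otimes> c''" by metis
  moreover have "c'' = (l \<otimes> (k \<otimes> h)) \<otimes> a \<otimes> inv (l \<otimes> (k \<otimes> h))"
    unfolding c''_def c'_def c_def using l k h a(1) by (simp add: conj_conj)
  ultimately show "\<exists>h\<in>carrier G. let c = h \<otimes> a \<otimes> inv h in c \<otimes> a \<noteq> a \<otimes> c \<and> c \<otimes> b \<noteq> b \<otimes> c"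
    using lb l k h by (intro bexI[of _ "l \<otimes> (k \<otimes> h)"]) (auto simp: Let_def c''_def)
qed

section \<open>Open sets invariant under a maximal subgroup\<close>

text \<open>If \<open>g\<close> moves \<open>z\<close>, then by injectivity it also moves
  \<open>g z\<close>, so \<open>f\<close> fixes both; the other case is symmetric.\<close>

lemma commute_if_disjoint:
  assumes f: "f \<in> carrier G" and g: "g \<in> carrier G"
    and disj: "\<And>z. z \<in> {0..1} \<Longrightarrow> f z = z \<or> g z = z"
  shows "f \<otimes> g = g \<otimes> f"
proof (rule eqI)
  fix z :: real assume z: "z \<in> {0..1}"
  have "f (g z) = g (f z)"
    using disj[OF z] disj[OF apply_in[OF g z]] disj[OF apply_in[OF f z]]
      apply_eq_iff[OF g apply_in[OF g z] z] apply_eq_iff[OF f apply_in[OF f z] z]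
    by metis
  then show "(f \<otimes> g) z = (g \<otimes> f) z" using f g z by (simp add: apply_mult)
qed (use f g in auto)

lemma stabiliser_subgroup:
  "subgroup {f \<in> carrier G. \<forall>z\<in>{0<..<1}. f z \<in> V \<longleftrightarrow> z \<in> V} G"
proof (rule subgroupI)
  show "{f \<in> carrier G. \<forall>z\<in>{0<..<1}. f z \<in> V \<longleftrightarrow> z \<in> V} \<noteq> {}"
    using apply_one by (auto intro!: exI[of _ \<one>])
next
  fix f assume f: "f \<in> {f \<in> carrier G. \<forall>z\<in>{0<..<1}. f z \<in> V \<longleftrightarrow> z \<in> V}"
  have "(inv f) z \<in> V \<longleftrightarrow> z \<in> V" if z: "z \<in> {0<..<1}" for z
  proof -
    have "(inv f) z \<in> {0<..<1}" using apply_in_interior[of "inv f" z] f z by simp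
    then have "f ((inv f) z) \<in> V \<longleftrightarrow> (inv f) z \<in> V" using f by blast
    then show ?thesis using apply_inv(2)[of f z] f z by simp
  qed
  then show "inv f \<in> {f \<in> carrier G. \<forall>z\<in>{0<..<1}. f z \<in> V \<longleftrightarrow> z \<in> V}"
    using f by simp
next
  fix f g
  assume "f \<in> {f \<in> carrier G. \<forall>z\<in>{0<..<1}. f z \<in> V \<longleftrightarrow> z \<in> V}"
    "g \<in> {f \<in> carrier G. \<forall>z\<in>{0<..<1}. f z \<in> V \<longleftrightarrow> z \<in> V}"
  then show "f \<otimes> g \<in> {f \<in> carrier G. \<forall>z\<in>{0<..<1}. f z \<in> V \<longleftrightarrow> z \<in> V}"
    using apply_in_interior[of g] by (auto simp: apply_mult)
qed auto

text \<open>A bump on an interval contained in \<open>V\<close> maps that interval onto itself and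
  fixes the rest, so it preserves \<open>V\<close>. The bounds \<open>s\<close> and \<open>t\<close>
  let the bump be placed on a chosen side of a point outside \<open>V\<close>.\<close>

lemma bump_in_stabiliser:
  assumes V: "open V" "V \<subseteq> {0<..<1}" and u: "u \<in> V" "s < u" "u < t"
  obtains p q a where "{p<..<q} \<subseteq> V" "s < p" "q < t" "a \<in> carrier G" "a \<noteq> \<one>"
    "\<And>z. z \<in> {0<..<1} \<Longrightarrow> a z \<in> V \<longleftrightarrow> z \<in> V"
    "\<And>z. z \<in> {0..1} \<Longrightarrow> z \<notin> {p<..<q} \<Longrightarrow> a z = z"
proof -
  have "open (V \<inter> {s<..<t})" "u \<in> V \<inter> {s<..<t}" using V u by auto
  \<comment> \<open>A closed ball puts the endpoints themselves into the open set, which gives the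
    strict bounds \<open>s < p\<close> and \<open>q < t\<close>.\<close>
  then obtain e where e: "e > 0" "cball u e \<subseteq> V \<inter> {s<..<t}"
    unfolding open_contains_cball by blast
  define p q where "p = u - e" and "q = u + e"
  have pq: "{p..q} \<subseteq> V \<inter> {s<..<t}"
    using e unfolding p_def q_def by (auto simp: cball_def dist_real_def subset_eq abs_le_iff)
  have plq: "p < q" using e by (simp add: p_def q_def)
  then have "p \<in> {p..q}" "q \<in> {p..q}" by auto
  then have mem: "p \<in> V \<inter> {s<..<t}" "q \<in> V \<inter> {s<..<t}" using pq by blast+
  then have pq01: "p \<in> {0<..<1}" "q \<in> {0<..<1}" using V by auto
  then have pq0: "0 \<le> p" "q \<le> 1" by auto
  obtain a w where a: "a \<in> carrier G" and a_out: "\<And>z. z \<in> {0..1} \<Longrightarrow> z \<notin> {p<..<q} \<Longrightarrow> a z = z"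
    and w: "w \<in> {p<..<q}" "w < a w"
    by (rule small_bump_exists[OF pq0(1) plq pq0(2)], rule that)
  have apq: "a p = p" "a q = q" using a_out pq01 by auto
  have "a z \<in> V \<longleftrightarrow> z \<in> V" if z: "z \<in> {0<..<1}" for z
  proof (cases "z \<in> {p<..<q}")
    case True
    then have "a z \<in> {p<..<q}"
      using apply_less_iff[OF a, of p z] apply_less_iff[OF a, of z q] apq pq01 z by auto
    moreover have "{p<..<q} \<subseteq> V" using pq by auto
    ultimately show ?thesis using True by blast
  next
    case False
    then show ?thesis using a_out z by simp
  qed
  moreover have "a \<noteq> \<one>" using w pq01 apply_one[of w] by auto
  moreover have "{p<..<q} \<subseteq> V" using pq by auto
  ultimately show thesis using mem a a_out by (intro that[of p q a]) auto
qed

text \<open>A conjugate of \<open>a\<close> commuting with neither bump has support on both sides of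
  \<open>k\<close>. That support lies in the interval \<open>h\<close> applied to
  \<open>{p<..<q}\<close>, which would then contain \<open>k\<close>; but it is part of
  \<open>V\<close>, since \<open>h\<close> preserves \<open>V\<close>.\<close>

lemma maximal_invariant_open_not_separated:
  assumes max: "maximal_subgroup H G" and ent: "conj_entangling (G\<lparr>carrier := H\<rparr>)"
    and V: "open V" "V \<subseteq> {0<..<1}"
    and inv: "\<And>f z. f \<in> H \<Longrightarrow> z \<in> {0<..<1} \<Longrightarrow> f z \<in> V \<longleftrightarrow> z \<in> V"
    and k: "k \<in> {0<..<1}" "k \<notin> V" and uv: "u \<in> V" "v \<in> V" "u < k" "k < v"
  shows False
proof -
  define K where "K = {f \<in> carrier G. \<forall>z\<in>{0<..<1}. f z \<in> V \<longleftrightarrow> z \<in> V}"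
  have H: "subgroup H G" using max by (simp add: maximal_subgroup_def)
  \<comment> \<open>Some element of the whole group carries \<open>k\<close>, a point outside
    \<open>V\<close>, into \<open>V\<close> near \<open>u\<close>.\<close>
  have "K \<noteq> carrier G"
  proof -
    obtain e where e: "e > 0" "ball u e \<subseteq> V" using V uv open_contains_ball by blast
    have u01: "u \<in> {0<..<1}" using uv V by blast
    define r where "r = min (u + e) 1"
    have *: "0 < k" "k < 1" "0 \<le> u" "u < r" "r \<le> 1" using e(1) u01 k(1) by (auto simp: r_def)
    obtain h where h: "h \<in> carrier G" "h k \<in> {u<..<r}"
      by (rule dense_orbits_supported[OF order_refl order_refl *], rule that)
    have "{u<..<r} \<subseteq> ball u e" by (auto simp: r_def dist_real_def)
    then have "h k \<in> V" using h(2) e(2) by blast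
    then have "h \<notin> K" using k by (auto simp: K_def)
    then show ?thesis using h(1) by blast
  qed
  moreover have "H \<subseteq> K" using inv subgroup.subset[OF H] by (auto simp: K_def)
  moreover have "subgroup K G" unfolding K_def by (rule stabiliser_subgroup)
  ultimately have HK: "H = K" using max unfolding maximal_subgroup_def by metis
  \<comment> \<open>Only the bounds facing \<open>k\<close> matter; these fill the outer ones with
    harmless values.\<close>
  have lt: "u - 1 < u" "v < v + 1" by simp_all
  obtain p q a where a: "{p<..<q} \<subseteq> V" "q < k" "a \<in> carrier G" "a \<noteq> \<one>"
    "\<And>z. z \<in> {0<..<1} \<Longrightarrow> a z \<in> V \<longleftrightarrow> z \<in> V"
    and a_out: "\<And>z. z \<in> {0..1} \<Longrightarrow> z \<notin> {p<..<q} \<Longrightarrow> a z = z"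
    by (rule bump_in_stabiliser[OF V uv(1) lt(1) uv(3)], rule that)
  obtain p' q' b where b: "{p'<..<q'} \<subseteq> V" "k < p'" "b \<in> carrier G" "b \<noteq> \<one>"
    "\<And>z. z \<in> {0<..<1} \<Longrightarrow> b z \<in> V \<longleftrightarrow> z \<in> V"
    and b_out: "\<And>z. z \<in> {0..1} \<Longrightarrow> z \<notin> {p'<..<q'} \<Longrightarrow> b z = z"
    by (rule bump_in_stabiliser[OF V uv(2) uv(4) lt(2)], rule that)
  have "a \<in> carrier (G\<lparr>carrier := H\<rparr>) - {\<one>}" "b \<in> carrier (G\<lparr>carrier := H\<rparr>) - {\<one>}"
    using a b by (auto simp: HK K_def)
  then obtain h where h: "h \<in> H"
    "let c = h \<otimes> a \<otimes> inv\<^bsub>G\<lparr>carrier := H\<rparr>\<^esub> h in c \<otimes> a \<noteq> a \<otimes> c \<and> c \<otimes> b \<noteq> b \<otimes> c"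
    using ent unfolding conj_entangling_def by fastforce
  have hG: "h \<in> carrier G" using h(1) by (simp add: HK K_def)
  define c where "c = h \<otimes> a \<otimes> inv h"
  have c: "c \<in> carrier G" using hG a(3) by (simp add: c_def)
  have nc: "c \<otimes> a \<noteq> a \<otimes> c" "c \<otimes> b \<noteq> b \<otimes> c"
    using h m_inv_consistent[OF H h(1)] by (auto simp: Let_def c_def)
  obtain y where y: "y \<in> {0..1}" "c y \<noteq> y" "a y \<noteq> y"
    using commute_if_disjoint[OF c a(3)] nc(1) by blast
  obtain z where z: "z \<in> {0..1}" "c z \<noteq> z" "b z \<noteq> z"
    using commute_if_disjoint[OF c b(3)] nc(2) by blast
  \<comment> \<open>Points moved by the conjugate \<open>c\<close> come from the support of
    \<open>a\<close>.\<close>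
  have pre: "(inv h) w \<in> {p<..<q}" if "w \<in> {0..1}" "c w \<noteq> w" for w
  proof (rule ccontr)
    assume "\<not> ?thesis"
    then have "a ((inv h) w) = (inv h) w"
      using a_out apply_in[of "inv h" w] hG that(1) by simp
    then show False
      using that apply_conj[OF hG a(3) that(1)] apply_inv(2)[OF hG that(1)] by (simp add: c_def)
  qed
  have "y \<in> {p<..<q}" "z \<in> {p'<..<q'}"
    using a_out[OF y(1)] y(3) b_out[OF z(1)] z(3) by blast+
  then have "y < k" "k < z" using a(2) b(2) by auto
  moreover have kI: "k \<in> {0..1}" using k by auto
  ultimately have "(inv h) y < (inv h) k" "(inv h) k < (inv h) z"
    using apply_less_iff[of "inv h"] hG y(1) z(1) by auto
  \<comment> \<open>Convexity: the point lies between the preimages of \<open>y\<close> and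
    \<open>z\<close>, both in the interval.\<close>
  then have "(inv h) k \<in> {p<..<q}"
    using pre[OF y(1,2)] pre[OF z(1,2)] by auto
  then have "(inv h) k \<in> V" using a(1) by blast
  moreover have "(inv h) k \<in> {0<..<1}" using apply_in_interior[of "inv h" k] hG k by simp
  ultimately have "h ((inv h) k) \<in> V" using inv[OF h(1)] by blast
  then show False using apply_inv(2)[OF hG kI] k by simp
qed

text \<open>Removing the fixed point from the open interval leaves an invariant open set, and the
  removed point separates it.\<close>

lemma maximal_no_fixed_point:
  assumes max: "maximal_subgroup H G" and ent: "conj_entangling (G\<lparr>carrier := H\<rparr>)"
    and s: "s \<in> {0<..<1}" and fixed: "\<And>f. f \<in> H \<Longrightarrow> f s = s"
  shows False
proof (rule maximal_invariant_open_not_separated[OF max ent, where V = "{0<..<1} - {s}"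
        and k = s and u = "s / 2" and v = "(s + 1) / 2"])
  have H: "H \<subseteq> carrier G" using max unfolding maximal_subgroup_def by (meson subgroup.subset)
  show "open ({0<..<1} - {s})" by (intro open_Diff) auto
  show "f z \<in> {0<..<1} - {s} \<longleftrightarrow> z \<in> {0<..<1} - {s}" if "f \<in> H" "z \<in> {0<..<1}" for f z
    using apply_in_interior[of f z] apply_eq_iff[of f z s] fixed[OF that(1)] that s H by auto
  show "s / 2 \<in> {0<..<1} - {s}" "(s + 1) / 2 \<in> {0<..<1} - {s}" "s / 2 < s" "s < (s + 1) / 2"
    using s by auto
qed (use s in auto)

lemma maximal_invariant_open_trivial:
  assumes max: "maximal_subgroup H G" and ent: "conj_entangling (G\<lparr>carrier := H\<rparr>)"
    and V: "open V" "V \<subseteq> {0<..<1}"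
    and inv: "\<And>f z. f \<in> H \<Longrightarrow> z \<in> {0<..<1} \<Longrightarrow> f z \<in> V \<longleftrightarrow> z \<in> V"
    and x: "x \<in> {0<..<1}" "x \<notin> V" and u: "u \<in> V"
  shows False
proof -
  have H: "subgroup H G" using max by (simp add: maximal_subgroup_def)
  have H_sub: "H \<subseteq> carrier G" by (rule subgroup.subset[OF H])
  have V01: "z \<in> {0<..<1}" if "z \<in> V" for z using V that by blast
  have inv_in: "f z \<in> V" if "f \<in> H" "z \<in> V" for f z
    using inv[OF that(1) V01[OF that(2)]] that(2) by blast
  have bdd: "bdd_above V" "bdd_below V"
    using V(2) by (meson bdd_above_Ioo bdd_above_mono, meson bdd_below_Ioo bdd_below_mono)
  have ne: "V \<noteq> {}" using u by blast
  have u01: "u \<in> {0<..<1}" by (rule V01[OF u])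
  have ux: "u \<noteq> x" using u x by blast
  show False
  proof (cases "(\<exists>z\<in>V. z < x) \<and> (\<exists>z\<in>V. x < z)")
    case True
    then obtain y z where "y \<in> V" "z \<in> V" "y < x" "x < z" by blast
    then show False
      by (intro maximal_invariant_open_not_separated[OF max ent V _ x, of y z] inv)
  next
    case False
    \<comment> \<open>The one-sided inequality for both \<open>f\<close> and \<open>inv f\<close>
      forces equality. The relation \<open>R\<close> lets one argument serve the supremum and the
      infimum.\<close>
    have fixed: "f s = s"
      if mono: "\<And>f. f \<in> H \<Longrightarrow> R s (f s)" and R: "R = (\<le>) \<or> R = (\<ge>)"
        and s: "s \<in> {0<..<1}" and f: "f \<in> H" for R :: "real \<Rightarrow> real \<Rightarrow> bool" and s f
    proof -
      have f': "f \<in> carrier G" "inv f \<in> H" using f H_sub subgroup.m_inv_closed[OF H] by auto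
      have sI: "s \<in> {0..1}" "(inv f) s \<in> {0..1}"
        using s apply_in[of "inv f" s] f' by auto
      show ?thesis
        using mono[OF f] mono[OF f'(2)] R apply_less_iff[OF f'(1) sI]
          apply_less_iff[OF f'(1) sI(2,1)] apply_inv(2)[OF f'(1) sI(1)] by auto
    qed
    show False
    proof (cases "u < x")
      case True
      then have le: "z \<le> x" if "z \<in> V" for z using False u that by force
      define s where "s = Sup V"
      have "u \<le> s" unfolding s_def using u bdd by (intro cSup_upper)
      moreover have "s \<le> x" unfolding s_def using ne le by (intro cSup_least)
      \<comment> \<open>Being squeezed between \<open>u\<close> and \<open>x\<close> keeps the
        supremum away from the endpoints 0 and 1, which every element fixes.\<close>
      ultimately have s: "s \<in> {0<..<1}" using u01 x by auto
      have "s \<le> f s" if f: "f \<in> H" for f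
        unfolding s_def
      proof (rule cSup_least[OF ne])
        fix z assume z: "z \<in> V"
        have fG: "f \<in> carrier G" "inv f \<in> H" using f H_sub subgroup.m_inv_closed[OF H] by auto
        \<comment> \<open>Each \<open>z\<close> in \<open>V\<close> is the image under
          \<open>f\<close> of a point of \<open>V\<close>, so \<open>f s\<close> is again an upper
          bound.\<close>
        have "(inv f) z \<in> V" using inv_in[OF fG(2) z] .
        then have "(inv f) z \<le> s" unfolding s_def using bdd by (intro cSup_upper)
        then have "f ((inv f) z) \<le> f s"
          using apply_less_iff[OF fG(1), of s "(inv f) z"] V01[OF \<open>(inv f) z \<in> V\<close>] s by force
        then show "z \<le> f (Sup V)"
          using apply_inv(2)[OF fG(1), of z] V01[OF z] by (simp add: s_def)
      qed
      then have "f s = s" if "f \<in> H" for f using fixed[of "(\<le>)" s f] s that by blast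
      then show False by (rule maximal_no_fixed_point[OF max ent s])
    next
      case nless: False
      then have le: "x \<le> z" if "z \<in> V" for z using False u ux that by force
      define s where "s = Inf V"
      have "s \<le> u" unfolding s_def using u bdd by (intro cInf_lower)
      moreover have "x \<le> s" unfolding s_def using ne le by (intro cInf_greatest)
      ultimately have s: "s \<in> {0<..<1}" using u01 x by auto
      have "f s \<le> s" if f: "f \<in> H" for f
        unfolding s_def
      proof (rule cInf_greatest[OF ne])
        fix z assume z: "z \<in> V"
        have fG: "f \<in> carrier G" "inv f \<in> H" using f H_sub subgroup.m_inv_closed[OF H] by auto
        have "(inv f) z \<in> V" using inv_in[OF fG(2) z] .
        then have "s \<le> (inv f) z" unfolding s_def using bdd by (intro cInf_lower)
        then have "f s \<le> f ((inv f) z)"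
          using apply_less_iff[OF fG(1), of "(inv f) z" s] V01[OF \<open>(inv f) z \<in> V\<close>] s by force
        then show "f (Inf V) \<le> z"
          using apply_inv(2)[OF fG(1), of z] V01[OF z] by (simp add: s_def)
      qed
      then have "f s = s" if "f \<in> H" for f using fixed[of "(\<ge>)" s f] s that by blast
      then show False by (rule maximal_no_fixed_point[OF max ent s])
    qed
  qed
qed

section \<open>Density of the orbits\<close>

lemma maximal_entangling_minimal:
  assumes max: "maximal_subgroup H G" and ent: "conj_entangling (G\<lparr>carrier := H\<rparr>)"
  shows "minimal_action (G\<lparr>carrier := H\<rparr>) {0<..<1} (\<lambda>h. restrict h {0<..<1})"
proof -
  have H: "subgroup H G" using max by (simp add: maximal_subgroup_def)
  have H_sub: "H \<subseteq> carrier G" by (rule subgroup.subset[OF H])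
  show ?thesis
    unfolding minimal_action_def minimal_action_axioms_def
  proof (intro conjI allI impI)
    show "group_action (G\<lparr>carrier := H\<rparr>) {0<..<1} (\<lambda>h. restrict h {0<..<1})"
      using group_action_thompson_F[OF n2] H unfolding G_def by blast
  next
    fix x :: real assume x: "x \<in> {0<..<1}"
    define O' where "O' = orbit (G\<lparr>carrier := H\<rparr>) (\<lambda>h. restrict h {0<..<1}) x"
    have O': "O' = (\<lambda>h. h x) ` H"
      using x by (auto simp: O'_def orbit_def)
    have xO: "x \<in> O'"
      unfolding O' using subgroup.one_closed[OF H] apply_one[of x] x
      by (intro image_eqI[of _ _ \<one>]) auto
    have O01: "O' \<subseteq> {0<..<1}"
      unfolding O' using apply_in_interior[OF _ x] H_sub by blast
    then have cl01: "closure O' \<subseteq> {0..1}"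
      by (intro closure_minimal) auto
    have O_inv: "f ` O' \<subseteq> O'" if f: "f \<in> H" for f
    proof
      fix y assume "y \<in> f ` O'"
      then obtain h where h: "h \<in> H" "y = f (h x)" by (auto simp: O')
      then have "(f \<otimes> h) x = y" using apply_mult[of f h x] f H_sub x by auto
      then show "y \<in> O'" using subgroup.m_closed[OF H f h(1)] by (auto simp: O')
    qed
    \<comment> \<open>The closure may contain 0 or 1, so continuity of \<open>f\<close> on the
      closed interval is used.\<close>
    have cl_inv: "f y \<in> closure O'" if f: "f \<in> H" and y: "y \<in> closure O'" for f y
    proof -
      have "f ` closure O' \<subseteq> closure O'"
      proof (rule image_closure_subset)
        show "continuous_on (closure O') f"
          using continuous_on_apply[of f] f H_sub cl01 continuous_on_subset by blast
        show "f ` O' \<subseteq> closure O'" using O_inv[OF f] closure_subset by blast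
      qed simp
      then show ?thesis using y by blast
    qed
    define V where "V = {0<..<1} - closure O'"
    have inv: "f z \<in> V \<longleftrightarrow> z \<in> V" if f: "f \<in> H" and z: "z \<in> {0<..<1}" for f z
    proof -
      have fG: "f \<in> carrier G" "inv f \<in> H" using f H_sub subgroup.m_inv_closed[OF H] by auto
      \<comment> \<open>The backward direction applies invariance of the closure to
        \<open>inv f\<close>.\<close>
      have "f z \<in> closure O' \<longleftrightarrow> z \<in> closure O'"
        using cl_inv[OF f, of z] cl_inv[OF fG(2), of "f z"] apply_inv(1)[OF fG(1), of z] z by auto
      then show ?thesis using apply_in_interior[OF fG(1) z] z by (simp add: V_def)
    qed
    have "V = {}"
    proof (rule ccontr)
      assume "V \<noteq> {}"
      then obtain u where "u \<in> V" by blast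
      moreover have "open V" unfolding V_def by (intro open_Diff) auto
      moreover have "x \<notin> V" using xO closure_subset by (auto simp: V_def)
      moreover have "V \<subseteq> {0<..<1}" by (auto simp: V_def)
      ultimately show False
        by (intro maximal_invariant_open_trivial[OF max ent _ _ _ x, of V u] inv)
    qed
    then show "{0<..<1} \<subseteq> closure (orbit (G\<lparr>carrier := H\<rparr>) (\<lambda>h. restrict h {0<..<1}) x)"
      unfolding V_def O'_def by blast
  qed
qed

end

theorem lemma3p3:
  fixes m n :: nat and H :: "(real \<Rightarrow> real) set"
  assumes "2 \<le> m" and "m \<le> n"
    and "maximal_subgroup H (thompson_F m)"
    and "(thompson_F m)\<lparr>carrier := H\<rparr> \<cong> thompson_F n"
  shows "minimal_action ((thompson_F m)\<lparr>carrier := H\<rparr>) {0<..<1} (\<lambda>h. restrict h {0<..<1})"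
proof -
  have n: "thompson n" and m: "thompson m"
    using assms(1,2) by (simp_all add: thompson_def)
  have "subgroup H (thompson_F m)"
    using assms(3) by (simp add: maximal_subgroup_def)
  then have "group ((thompson_F m)\<lparr>carrier := H\<rparr>)"
    using subgroup.subgroup_is_group group_thompson_F[OF assms(1)] by blast
  \<comment> \<open>The isomorphism enters only here: it transports the commutation property from
    \<open>F\<^sub>n\<close> to \<open>H\<close>.\<close>
  then have "conj_entangling ((thompson_F m)\<lparr>carrier := H\<rparr>)"
    using conj_entangling_iso[OF _ group_thompson_F assms(4)] thompson.conj_entangling[OF n]
      assms(1,2) by simp
  then show ?thesis
    using thompson.maximal_entangling_minimal[OF m assms(3)] by blast
qed

end
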